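(* Let $(C_k)_{k\in\mathbb{N}}$ be a consistent family of copulas $C_k$ in $\mathbb{R}^k$ with densities $c_k\colon[0,1]^k\to[0,\infty)$. Then for every $\mu\in\mathcal{M}^{\otimes}(H)\cap\mathcal{M}^c(H)$ the following are equivalent: (1) the family $(c_k)_{k\in\mathbb{N}}$ is uniformly integrable; (2) there exists a Borel probability measure $\nu$ on $H$ satisfying: (a) $(\nu\circ\pi_{e_1,\dots,e_k}^{-1}:k\in\mathbb{N})\lhd(\mu\circ\pi_{e_1,\dots,e_k}^{-1}:k\in\mathbb{N})$; (b) for each $k\in\mathbb{N}$ and $I_1,\dots,I_k\in\mathcal{I}$, $$\nu\circ\pi_{e_1,\dots,e_k}^{-1}\big(I_1\times\cdots\times I_k\big)=C_k\big(\mu_1(I_1),\dots,\mu_k(I_k)\big),$$ where $\mu_j:=\mu\circ\pi_{e_j}^{-1}$. In this situation the measure $\nu$ is absolutely continuous with respect to $\mu$.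
   Context: $H$ is a separable (real, infinite dimensional) Hilbert space with inner product $\langle\cdot,\cdot\rangle$ and a fixed orthonormal basis $(e_k)_{k\in\mathbb{N}}$, $\mathbb{N}=\{1,2,\dots\}$. For $k\le\ell$, $\pi_{e_k,\dots,e_\ell}(h)=(\langle h,e_k\rangle,\dots,\langle h,e_\ell\rangle)\in\mathbb{R}^{\ell-k+1}$. $\mathcal{I}:=\{(-\infty,x]:x\in\mathbb{R}\}$. $\mathcal{M}^{\otimes}(H)$ is the set of Borel probability measures $\mu$ on $H$ such that the image of $\mu$ under $h\mapsto(\langle h,e_k\rangle)_{k\in\mathbb{N}}$ is the product measure $\bigotimes_{k=1}^\infty\mu\circ\pi_{e_k}^{-1}$. $\mathcal{M}^c(H)$ is the set of Borel probability measures $\mu$ on $H$ such that for every $k\in\mathbb{N}$ the function $x\mapsto\mu\circ\pi_{e_k}^{-1}((-\infty,x])$ is continuous. A copula in $\mathbb{R}^k$ is a cumulative distribution function $C_k\colon[0,1]^k\to[0,1]$ (i.e. the restriction to $[0,1]^k$ of the distribution function of a probability measure on $[0,1]^k$) with uniform marginals: $C_k(1,\dots,1,u_j,1,\dots,1)=u_j$ for all $u_j\in[0,1]$, $j\in\{1,\dots,k\}$. It has density $c_k$ if $c_k\colon[0,1]^k\to[0,\infty)$ is measurable and $C_k(u_1,\dots,u_k)=\int_0^{u_1}\cdots\int_0^{u_k}c_k(v_1,\dots,v_k)\,dv_k\cdots dv_1$ for all $u_1,\dots,u_k\in[0,1]$. A family $(C_k)_{k\in\mathbb{N}}$ of copulas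 $C_k$ in $\mathbb{R}^k$ is consistent if $C_{k+1}(u_1,\dots,u_k,1)=C_k(u_1,\dots,u_k)$ for all $u_1,\dots,u_k\in[0,1]$, $k\in\mathbb{N}$. The family $(c_k)_{k\in\mathbb{N}}$ of densities is called uniformly integrable if $$\lim_{r\to\infty}\sup_{k\in\mathbb{N}}\int_{\{u\in[0,1]^k:\,c_k(u)\ge r\}}c_k(u)\,du=0.$$ Contiguity: for measurable spaces $(S_k,\mathcal{S}_k)$ with probability measures $P_k,Q_k$ on $\mathcal{S}_k$, $k\in\mathbb{N}$, one writes $(Q_k:k\in\mathbb{N})\lhd(P_k:k\in\mathbb{N})$ if for every sequence of sets $A_k\in\mathcal{S}_k$, $\lim_{k\to\infty}P_k(A_k)=0$ implies $\lim_{k\to\infty}Q_k(A_k)=0$. *)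

theory Defs
  imports "HOL-Probability.Probability"
begin

text \<open>
  Conventions.  Indices run over the positive integers, so sequences are functions on type
  \<^typ>\<open>nat\<close> whose value at \<open>0\<close> is never used.  Euclidean \<open>k\<close>-space with its Borel
  sets is the product \<open>PiM {1..k} (\<lambda>_. borel)\<close>; its points are functions that are extensional
  on \<open>{1..k}\<close>.
\<close>

subsection \<open>Measures on the Hilbert space\<close>

definition orthonormal_basis :: "(nat \<Rightarrow> 'h::real_inner) \<Rightarrow> bool" where
  "orthonormal_basis e \<longleftrightarrow>
     (\<forall>i\<ge>1. \<forall>j\<ge>1. e i \<bullet> e j = (if i = j then 1 else 0)) \<and>
     closure (span (e ` {1..})) = UNIV"

definition coords :: "(nat \<Rightarrow> 'h::real_inner) \<Rightarrow> nat set \<Rightarrow> 'h \<Rightarrow> (nat \<Rightarrow> real)" where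
  "coords e J h = (\<lambda>j\<in>J. h \<bullet> e j)"

definition image_measure ::
    "(nat \<Rightarrow> 'h::real_inner) \<Rightarrow> nat set \<Rightarrow> 'h measure \<Rightarrow> (nat \<Rightarrow> real) measure" where
  "image_measure e J \<mu> = distr \<mu> (PiM J (\<lambda>_. borel)) (coords e J)"

definition marginal :: "(nat \<Rightarrow> 'h::real_inner) \<Rightarrow> nat \<Rightarrow> 'h measure \<Rightarrow> real measure" where
  "marginal e j \<mu> = distr \<mu> borel (\<lambda>h. h \<bullet> e j)"

definition borel_prob_measures :: "'h::topological_space measure set" where
  "borel_prob_measures = {\<mu>. prob_space \<mu> \<and> sets \<mu> = sets borel}"

definition product_measures :: "(nat \<Rightarrow> 'h::real_inner) \<Rightarrow> 'h measure set" where
  "product_measures e =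
     {\<mu> \<in> borel_prob_measures. image_measure e {1..} \<mu> = PiM {1..} (\<lambda>k. marginal e k \<mu>)}"

definition continuous_measures :: "(nat \<Rightarrow> 'h::real_inner) \<Rightarrow> 'h measure set" where
  "continuous_measures e =
     {\<mu> \<in> borel_prob_measures. \<forall>k\<ge>1. continuous_on UNIV (cdf (marginal e k \<mu>))}"

definition half_lines :: "real set set" where
  "half_lines = {{..x} | x. True}"


subsection \<open>Copulas and their densities\<close>

text \<open>Lebesgue measure on the Borel sets of the unit cube.\<close>

definition unit_cube :: "nat \<Rightarrow> (nat \<Rightarrow> real) measure" where
  "unit_cube k = PiM {1..k} (\<lambda>_. restrict_space lborel {0..1})"

text \<open>Only the values of \<open>C\<close> on the unit cube matter; that they lie in \<open>[0,1]\<close> follows from the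
  representation as a distribution function.\<close>

definition copula :: "nat \<Rightarrow> ((nat \<Rightarrow> real) \<Rightarrow> real) \<Rightarrow> bool" where
  "copula k C \<longleftrightarrow>
     (\<exists>M. prob_space M \<and> sets M = sets (unit_cube k) \<and>
          (\<forall>u \<in> {1..k} \<rightarrow>\<^sub>E {0..1}. C u = measure M (\<Pi>\<^sub>E j\<in>{1..k}. {0..u j}))) \<and>
     (\<forall>j\<in>{1..k}. \<forall>t\<in>{0..1}. C (\<lambda>i\<in>{1..k}. if i = j then t else 1) = t)"

definition has_copula_density ::
    "nat \<Rightarrow> ((nat \<Rightarrow> real) \<Rightarrow> real) \<Rightarrow> ((nat \<Rightarrow> real) \<Rightarrow> real) \<Rightarrow> bool" where
  "has_copula_density k C c \<longleftrightarrow>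
     c \<in> borel_measurable (unit_cube k) \<and>
     (\<forall>v \<in> {1..k} \<rightarrow>\<^sub>E {0..1}. 0 \<le> c v) \<and>
     (\<forall>u \<in> {1..k} \<rightarrow>\<^sub>E {0..1}.
        ennreal (C u) = (\<integral>\<^sup>+v\<in>(\<Pi>\<^sub>E j\<in>{1..k}. {0..u j}). ennreal (c v) \<partial>unit_cube k))"

definition consistent_copulas :: "(nat \<Rightarrow> (nat \<Rightarrow> real) \<Rightarrow> real) \<Rightarrow> bool" where
  "consistent_copulas C \<longleftrightarrow>
     (\<forall>k\<ge>1. \<forall>u \<in> {1..k} \<rightarrow>\<^sub>E {0..1}. C (Suc k) (u(Suc k := 1)) = C k u)"

definition uniformly_integrable_densities :: "(nat \<Rightarrow> (nat \<Rightarrow> real) \<Rightarrow> real) \<Rightarrow> bool" where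
  "uniformly_integrable_densities c \<longleftrightarrow>
     ((\<lambda>r::real. SUP k\<in>{1..}.
         \<integral>\<^sup>+u\<in>{u \<in> {1..k} \<rightarrow>\<^sub>E {0..1}. c k u \<ge> r}. ennreal (c k u) \<partial>unit_cube k)
       \<longlongrightarrow> 0) at_top"


subsection \<open>Contiguity\<close>

text \<open>\<open>contiguous Q P\<close> stands for \<open>(Q k : k) \<lhd> (P k : k)\<close>; \<open>P k\<close> and \<open>Q k\<close> are meant to be
  probability measures on the same sigma-algebra.\<close>

definition contiguous :: "(nat \<Rightarrow> 'b measure) \<Rightarrow> (nat \<Rightarrow> 'b measure) \<Rightarrow> bool" where
  "contiguous Q P \<longleftrightarrow>
     (\<forall>A. (\<forall>k\<ge>1. A k \<in> sets (P k)) \<longrightarrow>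
          (\<lambda>k. measure (P k) (A k)) \<longlonglongrightarrow> 0 \<longrightarrow> (\<lambda>k. measure (Q k) (A k)) \<longlonglongrightarrow> 0)"


subsection \<open>Coupling a product measure by a family of copulas\<close>

definition copula_coupling ::
    "(nat \<Rightarrow> 'h::real_inner) \<Rightarrow> (nat \<Rightarrow> (nat \<Rightarrow> real) \<Rightarrow> real) \<Rightarrow> 'h measure \<Rightarrow> 'h measure \<Rightarrow> bool"
where
  "copula_coupling e C \<mu> \<nu> \<longleftrightarrow>
     (\<forall>k\<ge>1. \<forall>I. (\<forall>j\<in>{1..k}. I j \<in> half_lines) \<longrightarrow>
        measure (image_measure e {1..k} \<nu>) (\<Pi>\<^sub>E j\<in>{1..k}. I j) =
          C k (\<lambda>j\<in>{1..k}. measure (marginal e j \<mu>) (I j)))"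

end

theory Submission
  imports Defs
begin

text \<open>
  Put \<open>V j = F j \<langle>h, e j\<rangle>\<close> with \<open>F j\<close> the continuous distribution function of the \<open>j\<close>-th marginal
  of \<open>\<mu>\<close>.  Under \<open>\<mu>\<close> the \<open>V j\<close> are independent and uniform, so a measure \<open>\<nu>\<close> satisfies the
  copula condition iff on the sigma-algebra of the first \<open>k\<close> coordinates it has the density
  \<open>c k (V 1, \<dots>, V k)\<close>.  As these sigma-algebras increase, both uniform integrability of the
  densities and contiguity amount to uniform absolute continuity on the algebra of cylinder sets:
  small \<open>\<mu>\<close>-measure forces small \<open>\<nu>\<close>-measure.  This condition makes the additive set function
  defined by the densities continuous at \<open>{}\<close>, so that Caratheodory's theorem yields \<open>\<nu>\<close>, and it
  passes to all Borel sets by approximation, which gives absolute continuity.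
\<close>

subsection \<open>Uniform absolute continuity along a filtration\<close>

text \<open>The sets that can be approximated contain \<open>G\<close> and are closed under
  complements and countable unions. Finitely many measures are treated together because the absolute
  continuity argument needs one \<open>B\<close> that is good for two measures at once.\<close>

lemma sigma_sets_approx:
  assumes fin: "finite \<L>" and L: "\<And>L. L \<in> \<L> \<Longrightarrow> finite_measure L \<and> sets L = sigma_sets \<Omega> G"
    and alg: "algebra \<Omega> G" and A: "A \<in> sigma_sets \<Omega> G" and "0 < \<epsilon>"
  shows "\<exists>B\<in>G. \<forall>L\<in>\<L>. measure L (sym_diff A B) < \<epsilon>"
  using A \<open>0 < \<epsilon>\<close>
proof (induction A arbitrary: \<epsilon> rule: sigma_sets.induct)
  case (Basic a)
  then show ?case by (intro bexI[of _ a]) auto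
next
  case Empty
  interpret algebra \<Omega> G by fact
  show ?case using Empty by (intro bexI[of _ "{}"]) auto
next
  case (Compl a)
  interpret algebra \<Omega> G by fact
  obtain B where B: "B \<in> G" "\<forall>L\<in>\<L>. measure L (sym_diff a B) < \<epsilon>"
    using Compl.IH Compl.prems by blast
  have "a \<subseteq> \<Omega>" "B \<subseteq> \<Omega>"
    using Compl.hyps B(1) sigma_sets_into_sp[OF space_closed] space_closed by blast+
  then have "sym_diff (\<Omega> - a) (\<Omega> - B) = sym_diff a B" by blast
  then show ?case using B by (intro bexI[of _ "\<Omega> - B"]) auto
next
  case (Union a)
  interpret algebra \<Omega> G by fact
  \<comment> \<open>The tails of the union decrease to the empty set, so every measure of the finite
    family makes them small eventually, and one \<open>n\<close> serves all of them.\<close>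
  have "\<forall>\<^sub>F n in sequentially. \<forall>L\<in>\<L>. measure L ((\<Union>i. a i) - (\<Union>i<n. a i)) < \<epsilon> / 2"
  proof (intro eventually_ball_finite[OF fin] ballI)
    fix L assume "L \<in> \<L>"
    then interpret finite_measure L using L by blast
    have a: "a i \<in> sets L" for i using Union.hyps L[OF \<open>L \<in> \<L>\<close>] by auto
    have "(\<lambda>n. measure L ((\<Union>i. a i) - (\<Union>i<n. a i))) \<longlonglongrightarrow> measure L (\<Inter>n. (\<Union>i. a i) - (\<Union>i<n. a i))"
      using a by (intro finite_Lim_measure_decseq) (auto simp: decseq_def)
    also have "(\<Inter>n. (\<Union>i. a i) - (\<Union>i<n. a i)) = {}" by auto
    finally show "\<forall>\<^sub>F n in sequentially. measure L ((\<Union>i. a i) - (\<Union>i<n. a i)) < \<epsilon> / 2"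
      using Union.prems by (intro order_tendstoD(2)) auto
  qed
  then obtain n where n: "\<forall>L\<in>\<L>. measure L ((\<Union>i. a i) - (\<Union>i<n. a i)) < \<epsilon> / 2"
    using eventually_happens'[OF sequentially_bot] by fast
  \<comment> \<open>Each of the \<open>n\<close> sets kept gets an equal share of
    \<open>\<epsilon> / 2\<close>; the \<open>+ 1\<close> keeps the denominator positive when
    \<open>n\<close> is \<open>0\<close>.\<close>
  define \<eta> where "\<eta> = \<epsilon> / (2 * (real n + 1))"
  have "\<eta> > 0" using Union.prems by (auto simp: \<eta>_def)
  then obtain B where B: "\<And>i. B i \<in> G" "\<And>i L. L \<in> \<L> \<Longrightarrow> measure L (sym_diff (a i) (B i)) < \<eta>"
    using Union.IH by metis
  show ?case
  proof (intro bexI[of _ "\<Union>i<n. B i"] ballI)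
    fix L assume "L \<in> \<L>"
    then interpret finite_measure L using L by blast
    have [measurable]: "a i \<in> sets L" "B i \<in> sets L" for i
      using Union.hyps L[OF \<open>L \<in> \<L>\<close>] B(1) by auto
    have "measure L (sym_diff (\<Union>i. a i) (\<Union>i<n. B i))
        \<le> measure L (((\<Union>i. a i) - (\<Union>i<n. a i)) \<union> (\<Union>i<n. sym_diff (a i) (B i)))"
      by (intro finite_measure_mono) auto
    also have "\<dots> \<le> measure L ((\<Union>i. a i) - (\<Union>i<n. a i)) + measure L (\<Union>i<n. sym_diff (a i) (B i))"
      by (intro measure_Un_le) auto
    also have "measure L (\<Union>i<n. sym_diff (a i) (B i)) \<le> (\<Sum>i<n. measure L (sym_diff (a i) (B i)))"
      by (intro finite_measure_subadditive_finite) auto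
    also have "\<dots> \<le> (\<Sum>i<n. \<eta>)" using B(2)[OF \<open>L \<in> \<L>\<close>] by (intro sum_mono less_imp_le)
    also have "\<dots> \<le> \<epsilon> / 2" using Union.prems by (auto simp: \<eta>_def field_simps)
    finally show "measure L (sym_diff (\<Union>i. a i) (\<Union>i<n. B i)) < \<epsilon>"
      using n \<open>L \<in> \<L>\<close> by force
  qed (use B(1) in auto)
qed

text \<open>\<open>Q k\<close> is tested only on \<open>F k\<close>. Thus one condition covers
  measures that are meaningful only on their own level of the filtration and, for constant
  \<open>Q\<close>, a single measure on all levels.\<close>

definition uniformly_ac :: "(nat \<Rightarrow> 'a set set) \<Rightarrow> (nat \<Rightarrow> 'a measure) \<Rightarrow> 'a measure \<Rightarrow> bool" where
  "uniformly_ac F Q M \<longleftrightarrow>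
     (\<forall>\<epsilon>>0. \<exists>\<delta>>0. \<forall>k\<ge>1. \<forall>A\<in>F k. measure M A < \<delta> \<longrightarrow> measure (Q k) A \<le> \<epsilon>)"

locale generating_filtration = prob_space M for M :: "'a measure" +
  fixes F :: "nat \<Rightarrow> 'a set set"
  assumes sigma_algebra_F: "sigma_algebra (space M) (F k)"
    and F_Suc: "F k \<subseteq> F (Suc k)"
    and sets_eq_F: "sets M = sigma_sets (space M) (\<Union>k\<in>{1..}. F k)"
begin

lemma F_mono: "i \<le> j \<Longrightarrow> F i \<subseteq> F j"
  by (rule lift_Suc_mono_le[of F]) (rule F_Suc)

lemma algebra_UN_F: "algebra (space M) (\<Union>k\<in>{1..}. F k)"
proof -
  interpret F: sigma_algebra "space M" "F k" for k by (rule sigma_algebra_F)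
  have "a \<union> b \<in> (\<Union>k\<in>{1..}. F k)" if "a \<in> F i" "b \<in> F j" "i \<ge> 1" "j \<ge> 1" for a b and i j :: nat
    using that F_mono[of i "max i j"] F_mono[of j "max i j"]
    by (intro UN_I[of "max i j"] F.Un) auto
  moreover have "F k \<subseteq> Pow (space M)" for k using F.space_closed by blast
  moreover have "{} \<in> (\<Union>k\<in>{1..}. F k)" using F.empty_sets[of 1] by blast
  moreover have "space M - a \<in> (\<Union>k\<in>{1..}. F k)" if "a \<in> (\<Union>k\<in>{1..}. F k)" for a
    using that F.compl_sets by blast
  ultimately show ?thesis
    unfolding algebra_iff_Un by blast
qed

lemma F_sets: "k \<ge> 1 \<Longrightarrow> A \<in> F k \<Longrightarrow> A \<in> sets M"
  unfolding sets_eq_F by auto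

text \<open>The hypothesis speaks only of sets in the filtration. A null set is replaced by such a
  set, which is still small under \<open>M\<close>, hence small under \<open>N\<close>.\<close>

lemma absolutely_continuous_if_uniformly_ac:
  assumes N: "finite_measure N" "sets N = sets M" and ac: "uniformly_ac F (\<lambda>_. N) M"
  shows "absolutely_continuous M N"
proof -
  interpret N: finite_measure N by fact
  have "measure N A \<le> 0" if A: "A \<in> null_sets M" for A
  proof (rule field_le_epsilon)
    fix \<epsilon> :: real assume "0 < \<epsilon>"
    then obtain \<delta> where \<delta>: "\<delta> > 0" and *: "\<forall>k\<ge>1. \<forall>A\<in>F k. measure M A < \<delta> \<longrightarrow> measure N A \<le> \<epsilon> / 2"
      using ac[unfolded uniformly_ac_def, rule_format, of "\<epsilon> / 2"] by auto
    \<comment> \<open>The same \<open>B\<close> is close to \<open>A\<close> under both measures: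
      within \<delta> under \<open>M\<close>, so that the hypothesis applies to \<open>B\<close>,
      and within \<open>\<epsilon> / 2\<close> under \<open>N\<close>, to return from
      \<open>B\<close> to \<open>A\<close>.\<close>
    have "\<exists>B\<in>\<Union>k\<in>{1..}. F k. \<forall>L\<in>{M, N}. measure L (sym_diff A B) < min \<delta> (\<epsilon> / 2)"
      using N finite_measure_axioms \<delta> \<open>0 < \<epsilon>\<close> A sets_eq_F
      by (intro sigma_sets_approx[OF _ _ algebra_UN_F]) auto
    then obtain B k where B: "B \<in> F k" "k \<ge> 1" "measure M (sym_diff A B) < \<delta>"
      "measure N (sym_diff A B) < \<epsilon> / 2" by auto
    have [measurable]: "B \<in> sets M" "A \<in> sets M" "B \<in> sets N" "A \<in> sets N"
      using F_sets B A N(2) by auto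
    have "measure M B \<le> measure M A + measure M (sym_diff A B)"
      by (intro order_trans[OF finite_measure_mono measure_Un_le]) auto
    also have "measure M A = 0" using A by (simp add: measure_def null_setsD1)
    finally have "measure N B \<le> \<epsilon> / 2" using * B by auto
    moreover have "measure N A \<le> measure N B + measure N (sym_diff A B)"
      by (intro order_trans[OF N.finite_measure_mono measure_Un_le]) auto
    ultimately show "measure N A \<le> 0 + \<epsilon>" using B by simp
  qed
  then show ?thesis
    using N unfolding absolutely_continuous_def
    by (auto simp: null_sets_def N.emeasure_eq_measure measure_le_0_iff)
qed

text \<open>Consistency turns the \<open>Q k\<close> into one additive set function on the algebra;
  Caratheodory's theorem asks for its continuity at \<open>{}\<close>. This is inherited from
  \<open>M\<close>: along sets decreasing to \<open>{}\<close> the \<open>M\<close>-measures vanish,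
  and uniform absolute continuity carries this over, whatever the levels of the sets.\<close>

lemma extension_if_uniformly_ac:
  assumes Q: "\<And>k. k \<ge> 1 \<Longrightarrow> prob_space (Q k) \<and> sets (Q k) = sets M"
    and consistent: "\<And>k A. k \<ge> 1 \<Longrightarrow> A \<in> F k \<Longrightarrow> emeasure (Q (Suc k)) A = emeasure (Q k) A"
    and ac: "uniformly_ac F Q M"
  obtains N where "prob_space N" "sets N = sets M"
    "\<And>k A. k \<ge> 1 \<Longrightarrow> A \<in> F k \<Longrightarrow> emeasure N A = emeasure (Q k) A"
proof -
  interpret F: sigma_algebra "space M" "F k" for k by (rule sigma_algebra_F)
  interpret G: algebra "space M" "\<Union>k\<in>{1..}. F k" by (rule algebra_UN_F)
  \<comment> \<open>A set lies on many levels. The least one is taken for definiteness; by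
    consistency every other level gives the same value.\<close>
  define f where "f A = emeasure (Q (LEAST k. k \<ge> 1 \<and> A \<in> F k)) A" for A
  have eq: "emeasure (Q n) A = emeasure (Q k) A" if "k \<le> n" "k \<ge> 1" "A \<in> F k" for k n A
    using that
  proof (induction rule: dec_induct)
    case (step n)
    then show ?case using F_mono[of k n] consistent[of n A] by auto
  qed auto
  have f: "f A = emeasure (Q k) A" if "k \<ge> 1" "A \<in> F k" for k A
  proof -
    let ?P = "\<lambda>k. k \<ge> 1 \<and> A \<in> F k"
    have "?P (LEAST k. ?P k)" using that by (intro LeastI[of ?P]) auto
    moreover have "(LEAST k. ?P k) \<le> k" using that by (intro Least_le[of ?P]) auto
    ultimately show ?thesis unfolding f_def using eq that by metis
  qed
  have "\<exists>\<mu>. (\<forall>A\<in>\<Union>k\<in>{1..}. F k. \<mu> A = f A) \<and>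
      measure_space (space M) (sigma_sets (space M) (\<Union>k\<in>{1..}. F k)) \<mu>"
  proof (rule G.caratheodory_empty_continuous)
    show "positive (\<Union>k\<in>{1..}. F k) f"
      using f[of 1 "{}"] F.empty_sets by (auto simp: positive_def)
    have "f (A \<union> B) = f A + f B" if "i \<ge> 1" "j \<ge> 1" "A \<in> F i" "B \<in> F j" "A \<inter> B = {}" for i j A B
    proof -
      let ?k = "max i j"
      have AB: "A \<in> F ?k" "B \<in> F ?k" using that F_mono[of i ?k] F_mono[of j ?k] by auto
      then have "A \<in> sets (Q ?k)" "B \<in> sets (Q ?k)" using that F_sets[of ?k] Q[of ?k] by auto
      then show ?thesis
        using AB f[of ?k] that F.Un[of A ?k B] by (simp add: plus_emeasure le_max_iff_disj)
    qed
    then show "additive (\<Union>k\<in>{1..}. F k) f" by (auto simp: additive_def)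
    show "f A \<noteq> \<infinity>" if A: "A \<in> (\<Union>k\<in>{1..}. F k)" for A
    proof -
      obtain k where k: "k \<ge> 1" "A \<in> F k" using A by auto
      interpret Q: prob_space "Q k" using k Q by simp
      show ?thesis using f[OF k] by simp
    qed
    fix A :: "nat \<Rightarrow> 'a set"
    assume A: "range A \<subseteq> (\<Union>k\<in>{1..}. F k)" "decseq A" "(\<Inter>i. A i) = {}"
    have A_sets: "A i \<in> sets M" for i using A(1) F_sets by blast
    have M0: "(\<lambda>i. measure M (A i)) \<longlonglongrightarrow> 0"
      using finite_Lim_measure_decseq[of A] A_sets A(2,3) by auto
    show "(\<lambda>i. f (A i)) \<longlonglongrightarrow> 0"
    proof (rule order_tendstoI)
      fix x :: ennreal assume "0 < x"
      \<comment> \<open>The values of \<open>f\<close> are extended reals, whereas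
        \<open>uniformly_ac\<close> has a real bound, so a positive real is chosen below the
        possibly infinite \<open>x\<close>.\<close>
      then obtain \<epsilon> where \<epsilon>: "0 < \<epsilon>" "ennreal \<epsilon> < x"
      proof (cases x)
        case (real r)
        then show ?thesis using \<open>0 < x\<close> that[of "r / 2"] by (auto simp: ennreal_less_iff)
      next
        case top
        then show ?thesis using that[of 1] by simp
      qed
      obtain \<delta> where \<delta>: "\<delta> > 0" "\<forall>k\<ge>1. \<forall>A\<in>F k. measure M A < \<delta> \<longrightarrow> measure (Q k) A \<le> \<epsilon>"
        using ac \<epsilon>(1) unfolding uniformly_ac_def by blast
      show "\<forall>\<^sub>F i in sequentially. f (A i) < x"
        using order_tendstoD(2)[OF M0 \<delta>(1)]
      proof eventually_elim
        case (elim i)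
        obtain k where k: "k \<ge> 1" "A i \<in> F k" using A(1) by blast
        interpret Q: prob_space "Q k" using k Q by simp
        have "measure (Q k) (A i) \<le> \<epsilon>" using \<delta>(2) k elim by auto
        then show ?case using \<epsilon> f[OF k] 
          by (simp add: Q.emeasure_eq_measure) (meson ennreal_leI le_less_trans)
      qed
    qed auto
  qed
  then obtain \<mu> where \<mu>: "\<And>A. A \<in> (\<Union>k\<in>{1..}. F k) \<Longrightarrow> \<mu> A = f A"
    "measure_space (space M) (sets M) \<mu>" unfolding sets_eq_F by blast
  define N where "N = measure_of (space M) (sets M) \<mu>"
  have N: "sets N = sets M" "space N = space M" by (auto simp: N_def)
  have em: "emeasure N A = emeasure (Q k) A" if "k \<ge> 1" "A \<in> F k" for k A
  proof -
    have "emeasure N A = \<mu> A"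
      using \<mu>(2) F_sets that unfolding N_def measure_space_def
      by (intro emeasure_measure_of_sigma) auto
    then show ?thesis using f \<mu>(1) that by force
  qed
  \<comment> \<open>The whole space already belongs to \<open>F 1\<close>, so the total mass of
    \<open>N\<close> is that of \<open>Q 1\<close>.\<close>
  have "emeasure (Q 1) (space M) = 1"
    using Q[of 1] prob_space.emeasure_space_1 sets_eq_imp_space_eq[of "Q 1" M] by fastforce
  then have "prob_space N" 
    using em[of 1 "space M"] F.top by (intro prob_spaceI) (simp add: N)
  from that[OF this N(1) em] show thesis .
qed

text \<open>Otherwise there are sets with vanishing \<open>M\<close>-measure but
  \<open>N\<close>-measure above a fixed \<epsilon>. Their levels may repeat or leave gaps, so they
  are rearranged into a sequence with one set per level, to which contiguity applies.\<close>

lemma uniformly_ac_if_contiguous: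
  assumes N: "finite_measure N"
    and contig: "\<And>A. (\<And>k. k \<ge> 1 \<Longrightarrow> A k \<in> F k) \<Longrightarrow> (\<lambda>k. measure M (A k)) \<longlonglongrightarrow> 0 \<Longrightarrow>
        (\<lambda>k. measure N (A k)) \<longlonglongrightarrow> 0"
  shows "uniformly_ac F (\<lambda>_. N) M"
proof (rule ccontr)
  interpret F: sigma_algebra "space M" "F k" for k by (rule sigma_algebra_F)
  assume "\<not> uniformly_ac F (\<lambda>_. N) M"
  then obtain \<epsilon> where \<epsilon>: "\<epsilon> > 0"
    and "\<And>\<delta>. \<delta> > 0 \<Longrightarrow> \<exists>k\<ge>1. \<exists>A\<in>F k. measure M A < \<delta> \<and> measure N A > \<epsilon>"
    unfolding uniformly_ac_def by (auto simp: not_le)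
  then have "\<forall>n. \<exists>k A. k \<ge> 1 \<and> A \<in> F k \<and> measure M A < 1 / real (Suc n) \<and> measure N A > \<epsilon>"
    by (meson of_nat_0_less_iff zero_less_Suc zero_less_divide_1_iff)
  then obtain k A where kA: "\<And>n. k n \<ge> 1" "\<And>n. A n \<in> F (k n)"
      "\<And>n. measure M (A n) < 1 / real (Suc n)" "\<And>n. measure N (A n) > \<epsilon>"
    by metis
  \<comment> \<open>Since the filtration increases, the index of each set may be raised to make the indices
    strictly increasing.\<close>
  define m where "m n = (\<Sum>i\<le>n. k i)" for n
  have m: "strict_mono m" 
    using kA(1) by (intro strict_mono_Suc_iff[THEN iffD2]) (auto simp: m_def Suc_le_eq)
  have "k n \<le> m n" for n unfolding m_def by (rule member_le_sum) auto
  then have Am: "A n \<in> F (m n)" for n using kA(2) F_mono by blast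
  \<comment> \<open>Levels not hit by \<open>m\<close> get the empty set, of measure
    \<open>0\<close>, so convergence along all levels reduces to convergence along
    \<open>m\<close>.\<close>
  define B where "B j = (if j \<in> range m then A (inv m j) else {})" for j
  have Bm: "B (m n) = A n" for n
    using m by (simp add: B_def inv_f_f strict_mono_imp_inj_on)
  have "(\<lambda>j. measure M (B j)) \<longlonglongrightarrow> 0"
  proof (rule LIMSEQ_I)
    fix r :: real assume "0 < r"
    then obtain n where n: "1 / real (Suc n) < r" using nat_approx_posE by blast
    have "measure M (B j) < r" if "j \<ge> m n" for j
    proof (cases "j \<in> range m")
      case True
      then obtain n' where n': "j = m n'" by auto
      then have "n \<le> n'" using that m by (simp add: strict_mono_less_eq)
      then have "1 / real (Suc n') \<le> 1 / real (Suc n)" by (simp add: field_simps)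
      then show ?thesis using kA(3)[of n'] n by (simp add: n' Bm)
    qed (use \<open>0 < r\<close> in \<open>simp add: B_def\<close>)
    then show "\<exists>no. \<forall>j\<ge>no. norm (measure M (B j) - 0) < r" by auto
  qed
  moreover have "B j \<in> F j" for j using Am Bm by (auto simp: B_def F.empty_sets inv_f_f strict_mono_imp_inj_on[OF m])
  ultimately have "(\<lambda>j. measure N (B j)) \<longlonglongrightarrow> 0" by (intro contig)
  from LIMSEQ_subseq_LIMSEQ[OF this m] have "(\<lambda>n. measure N (A n)) \<longlonglongrightarrow> 0"
    by (simp add: o_def Bm)
  then have "\<epsilon> \<le> 0" using kA(4) by (intro LIMSEQ_le_const[of _ 0 \<epsilon>]) (auto intro: less_imp_le)
  with \<epsilon> show False by simp
qed

end

subsection \<open>The probability integral transform\<close>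

context real_distribution
begin

text \<open>Unless it is empty or the whole line, the sublevel set is a closed half-line ending at
  its supremum, where a continuous distribution function takes exactly the value
  \<open>a\<close>.\<close>

lemma emeasure_cdf_le:
  assumes cont: "continuous_on UNIV (cdf M)" and a: "a \<in> {0..1}"
  shows "emeasure M {x. cdf M x \<le> a} = ennreal a"
proof -
  let ?S = "{x. cdf M x \<le> a}"
  consider "a = 1" | "a < 1" "?S = {}" | "a < 1" "?S \<noteq> {}" using a by force
  then show ?thesis
  proof cases
    case 1
    then have "?S = space M" using cdf_bounded_prob by auto
    then show ?thesis using 1 emeasure_space_1 by simp
  next
    case 2
    \<comment> \<open>The distribution function tends to \<open>0\<close> at minus infinity, so an
      empty sublevel set forces \<open>a = 0\<close>.\<close>
    have "\<not> 0 < a"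
    proof
      assume "0 < a"
      then obtain x where "cdf M x < a"
        using eventually_happens'[OF _ order_tendstoD(2)[OF cdf_lim_at_bot]] by force
      with 2 show False using less_imp_le by blast
    qed
    then show ?thesis using 2 a by simp
  next
    case 3
    obtain y where "a < cdf M y"
      using eventually_happens'[OF _ order_tendstoD(1)[OF cdf_lim_at_top_prob \<open>a < 1\<close>]] by force
    have "x \<le> y" if "cdf M x \<le> a" for x
      using cdf_nondecreasing[of y x] that \<open>a < cdf M y\<close> by linarith
    then have bdd: "bdd_above ?S" by (intro bdd_aboveI[of _ y]) auto
    have "closed ?S" using cont by (intro closed_Collect_le continuous_intros) auto
    then have s: "Sup ?S \<in> ?S" using closed_contains_Sup[OF 3(2) bdd] by simp
    have "?S = {..Sup ?S}"
    proof (intro set_eqI iffI)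
      fix x assume "x \<in> {..Sup ?S}"
      then have "cdf M x \<le> cdf M (Sup ?S)" by (intro cdf_nondecreasing) simp
      with s show "x \<in> ?S" by simp
    qed (use cSup_upper[OF _ bdd] in simp)
    \<comment> \<open>To the right of the supremum the values exceed \<open>a\<close>, hence so
      does, weakly, the right limit. Membership of the supremum in the set gives the opposite
      inequality.\<close>
    moreover have "a \<le> cdf M (Sup ?S)"
    proof (rule tendsto_lowerbound)
      show "(cdf M \<longlongrightarrow> cdf M (Sup ?S)) (at_right (Sup ?S))"
        using cdf_is_right_cont by (simp add: continuous_within)
      have "\<forall>\<^sub>F x in at_right (Sup ?S). Sup ?S < x" by (simp add: eventually_at_right_less)
      then show "\<forall>\<^sub>F x in at_right (Sup ?S). a \<le> cdf M x"
      proof eventually_elim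
        case (elim x)
        then have "x \<notin> ?S" using cSup_upper[OF _ bdd] by (meson leD)
        then show ?case by simp
      qed
    qed simp
    ultimately show ?thesis using s by (simp add: emeasure_eq_measure cdf_def2)
  qed
qed

text \<open>One direction is monotonicity. The other fails only where the distribution function
  stays constant to the right of \<open>x\<close>; this set is null because the sublevel set and the
  half-line both have mass \<open>cdf M x\<close>.\<close>

lemma AE_le_iff_cdf_le:
  assumes cont: "continuous_on UNIV (cdf M)"
  shows "AE y in M. y \<le> x \<longleftrightarrow> cdf M y \<le> cdf M x"
proof (rule AE_I)
  have [measurable]: "cdf M \<in> borel_measurable borel"
    using cont by (rule borel_measurable_continuous_onI)
  show "{y \<in> space M. \<not> (y \<le> x \<longleftrightarrow> cdf M y \<le> cdf M x)} \<subseteq> {y. cdf M y \<le> cdf M x} - {..x}"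
    using cdf_nondecreasing by auto
  have [measurable]: "{y. cdf M y \<le> cdf M x} \<in> sets borel" by measurable
  have "emeasure M ({y. cdf M y \<le> cdf M x} - {..x}) = emeasure M {y. cdf M y \<le> cdf M x} - emeasure M {..x}"
    using cdf_nondecreasing by (intro emeasure_Diff) auto
  then show "emeasure M ({y. cdf M y \<le> cdf M x} - {..x}) = 0"
    using emeasure_cdf_le[OF cont, of "cdf M x"] cdf_bounded_prob cdf_nonneg
    by (simp add: emeasure_eq_measure cdf_def2)
  show "{y. cdf M y \<le> cdf M x} - {..x} \<in> sets M" by simp
qed

lemma distr_cdf_uniform:
  assumes cont: "continuous_on UNIV (cdf M)"
  shows "distr M (restrict_space lborel {0..1}) (cdf M) = restrict_space lborel {0..1}"
proof (rule measure_eqI)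
  have [measurable]: "cdf M \<in> borel_measurable borel"
    using cont by (rule borel_measurable_continuous_onI)
  then have cdf_M[measurable]: "cdf M \<in> borel_measurable M" by simp
  have cdf_U: "cdf M \<in> measurable M (restrict_space lborel {0..1})"
    by (rule measurable_restrict_space2) (auto simp: cdf_nonneg cdf_bounded_prob)
  interpret U: prob_space "restrict_space lborel {0..1::real}"
    by (rule prob_spaceI) (simp add: emeasure_restrict_space space_restrict_space)
  have id[measurable]: "(\<lambda>x. x) \<in> measurable (restrict_space lborel {0..1}) borel"
    by (intro measurable_restrict_space1) simp
  \<comment> \<open>Distribution functions determine laws on the whole line, so both laws are
    compared there first; the values on Borel subsets of the unit interval follow.\<close>
  have eq: "distr M borel (cdf M) = distr (restrict_space lborel {0..1}) borel (\<lambda>x. x)"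
  proof (rule cdf_unique)
    show "real_distribution (distr M borel (cdf M))" by simp
    show "real_distribution (distr (restrict_space lborel {0..1}) borel (\<lambda>x. x))" by simp
    show "cdf (distr M borel (cdf M)) = cdf (distr (restrict_space lborel {0..1}) borel (\<lambda>x. x))"
    proof
      fix a :: real
      have cdf_left: "cdf (distr M borel (cdf M)) a = measure M {x. cdf M x \<le> a}"
        by (simp add: cdf_def2 measure_distr vimage_def)
      have cdf_right: "cdf (distr (restrict_space lborel {0..1}) borel (\<lambda>x. x)) a
          = measure lborel ({0..1} \<inter> {..a})"
        by (simp add: cdf_def2 measure_distr measure_restrict_space space_restrict_space Int_commute)
      consider "a < 0" | "a \<in> {0..1}" | "a > 1" by force
      then show "cdf (distr M borel (cdf M)) a = cdf (distr (restrict_space lborel {0..1}) borel (\<lambda>x. x)) a"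
      proof cases
        case 1
        then have "{x. cdf M x \<le> a} = {}" "{0..1} \<inter> {..a} = {}"
          using cdf_nonneg by (auto simp: not_le intro: less_le_trans)
        then show ?thesis unfolding cdf_left cdf_right by simp
      next
        case 2
        then have "{0..1} \<inter> {..a} = {0..a}" by auto
        then show ?thesis
          unfolding cdf_left cdf_right
          using emeasure_cdf_le[OF cont 2] 2 by (simp add: emeasure_eq_measure)
      next
        case 3
        then have "{x. cdf M x \<le> a} = space M" "{0..1} \<inter> {..a} = {0..1}"
          using 3 by (auto intro!: order_trans[OF cdf_bounded_prob])
        then show ?thesis unfolding cdf_left cdf_right using prob_space by simp
      qed
    qed
  qed
  fix A assume "A \<in> sets (distr M (restrict_space lborel {0..1}) (cdf M))"
  then have A: "A \<in> sets (restrict_space lborel {0..1})" by simp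
  then have A': "A \<in> sets borel" "A \<subseteq> {0..1}" by (auto simp: sets_restrict_space)
  have "emeasure (distr M (restrict_space lborel {0..1}) (cdf M)) A = emeasure (distr M borel (cdf M)) A"
    using A A' cdf_U by (simp add: emeasure_distr)
  also have "\<dots> = emeasure (restrict_space lborel {0..1}) A"
    unfolding eq using A' by (simp add: emeasure_distr space_restrict_space Int_absorb2)
  finally show "emeasure (distr M (restrict_space lborel {0..1}) (cdf M)) A = \<dots>" .
qed simp

end

section \<open>Uniqueness of finite measures on finite powers of the line\<close>

text \<open>The lower orthants are closed under intersection, generate the product sigma-algebra and
  exhaust the space along the diagonal corners.\<close>

lemma measure_eqI_PiM_atMost:
  fixes M N :: "('i \<Rightarrow> real) measure"
  assumes I: "finite I" and M: "finite_measure M"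
    and sets: "sets M = sets (PiM I (\<lambda>_. borel))" "sets N = sets (PiM I (\<lambda>_. borel))"
    and eq: "\<And>x. emeasure M (\<Pi>\<^sub>E i\<in>I. {..x i}) = emeasure N (\<Pi>\<^sub>E i\<in>I. {..x i})"
  shows "M = N"
proof -
  interpret M: finite_measure M by fact
  define P where "P = range (\<lambda>x. \<Pi>\<^sub>E i\<in>I. {..x i :: real})"
  \<comment> \<open>This is the generator in the form produced by \<open>sets_PiM_sigma\<close>,
    with the index set as its only block; it is then identified with the orthants in
    \<open>P\<close>.\<close>
  define P' where "P' = {{f\<in>(\<Pi>\<^sub>E i\<in>I. UNIV). \<forall>i\<in>j. f i \<in> A i} | A j. j \<in> {I} \<and> A \<in> Pi j (\<lambda>_. range (atMost :: real \<Rightarrow> _))}"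
  have P': "P' = P"
  proof
    show "P' \<subseteq> P"
    proof
      fix X assume "X \<in> P'"
      then obtain A where A: "X = {f\<in>(\<Pi>\<^sub>E i\<in>I. UNIV). \<forall>i\<in>I. f i \<in> A i}" "\<forall>i\<in>I. A i \<in> range (atMost :: real \<Rightarrow> _)"
        unfolding P'_def by auto
      from A(2) have "\<forall>i\<in>I. \<exists>y. A i = {..y}" by auto
      from bchoice[OF this] obtain x where "\<forall>i\<in>I. A i = {..x i}" by blast
      then have "X = (\<Pi>\<^sub>E i\<in>I. {..x i})" unfolding A(1) by (auto simp: PiE_iff extensional_def)
      then show "X \<in> P" unfolding P_def by blast
    qed
    have "(\<Pi>\<^sub>E i\<in>I. {..x i}) \<in> P'" for x :: "'i \<Rightarrow> real"
      unfolding P'_def by (auto intro!: exI[of _ "\<lambda>i. {..x i}"] simp: PiE_iff extensional_def)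
    then show "P \<subseteq> P'" unfolding P_def by auto
  qed
  have "sets (PiM I (\<lambda>_. sigma UNIV (range (atMost :: real \<Rightarrow> _)))) = sets (sigma (\<Pi>\<^sub>E i\<in>I. UNIV) P')"
    unfolding P'_def
  proof (rule sets_PiM_sigma)
    have "(UNIV :: real set) = \<Union>(range (\<lambda>n::nat. {..real n}))"
      by (auto intro: real_arch_simple)
    then show "\<exists>S\<subseteq>range (atMost :: real \<Rightarrow> _). countable S \<and> UNIV = \<Union>S"
      by (intro exI[of _ "range (\<lambda>n::nat. {..real n})"]) auto
  qed (use I in auto)
  then have sets_P: "sets (PiM I (\<lambda>_. borel :: real measure)) = sigma_sets (\<Pi>\<^sub>E i\<in>I. UNIV) P"
    unfolding P' borel_eq_atMost[symmetric] by (subst (asm) sets_measure_of) (auto simp: P_def)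
  show ?thesis
  proof (rule measure_eqI_generator_eq)
    show "Int_stable P"
    proof (rule Int_stableI)
      fix a b assume "a \<in> P" "b \<in> P"
      then obtain x y where "a = (\<Pi>\<^sub>E i\<in>I. {..x i})" "b = (\<Pi>\<^sub>E i\<in>I. {..y i})"
        unfolding P_def by auto
      then have "a \<inter> b = (\<Pi>\<^sub>E i\<in>I. {..min (x i) (y i)})" by (auto simp: PiE_iff)
      then show "a \<inter> b \<in> P" unfolding P_def by (intro range_eqI[of _ _ "\<lambda>i. min (x i) (y i)"])
    qed
    show "P \<subseteq> Pow (\<Pi>\<^sub>E i\<in>I. UNIV)" unfolding P_def by auto
    show "range (\<lambda>n::nat. \<Pi>\<^sub>E i\<in>I. {..real n}) \<subseteq> P" unfolding P_def by auto
    show "(\<Union>n. \<Pi>\<^sub>E i\<in>I. {..real n}) = (\<Pi>\<^sub>E i\<in>I. UNIV)"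
    proof (intro set_eqI iffI)
      fix f :: "'i \<Rightarrow> real" assume f: "f \<in> (\<Pi>\<^sub>E i\<in>I. UNIV)"
      \<comment> \<open>The sum of the absolute values dominates every coordinate, so one corner
        serves all of them.\<close>
      obtain n :: nat where n: "(\<Sum>i\<in>I. \<bar>f i\<bar>) \<le> real n" using real_arch_simple by blast
      have "f i \<le> real n" if "i \<in> I" for i
        using member_le_sum[OF that, of "\<lambda>i. \<bar>f i\<bar>"] I n by simp
      then show "f \<in> (\<Union>n. \<Pi>\<^sub>E i\<in>I. {..real n})" using f by (auto simp: PiE_iff)
    qed auto
    show "emeasure M (\<Pi>\<^sub>E i\<in>I. {..real n}) \<noteq> \<infinity>" for n by simp
    show "emeasure M X = emeasure N X" if "X \<in> P" for X using that eq by (auto simp: P_def)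
  qed (use sets sets_P in simp_all)
qed

subsection \<open>Cylinder sets in the Hilbert space\<close>

text \<open>The partial sums are linear contractions, and each vector in the span is eventually
  fixed by them. Density of the span carries convergence over to every \<open>h\<close>.\<close>

lemma orthonormal_expansion:
  fixes e :: "nat \<Rightarrow> 'h::real_inner"
  assumes "orthonormal_basis e"
  shows "(\<lambda>n. \<Sum>j=1..n. (h \<bullet> e j) *\<^sub>R e j) \<longlonglongrightarrow> h"
proof (rule metric_LIMSEQ_I)
  define P where "P n v = (\<Sum>j=1..n. (v \<bullet> e j) *\<^sub>R e j)" for n v
  have ortho: "e i \<bullet> e j = (if i = j then 1 else 0)" if "i \<ge> 1" "j \<ge> 1" for i j
    using assms that unfolding orthonormal_basis_def by blast
  have P_add: "P n (u + v) = P n u + P n v" for n u v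
    by (simp add: P_def inner_add_left scaleR_add_left sum.distrib)
  have P_scale: "P n (r *\<^sub>R v) = r *\<^sub>R P n v" for n r v
    by (simp add: P_def scaleR_sum_right)
  have P_norm: "norm (P n v) \<le> norm v" for n v
  proof -
    have e_P: "e i \<bullet> P n v = v \<bullet> e i" if "i \<in> {1..n}" for i
    proof -
      have "e i \<bullet> P n v = (\<Sum>j=1..n. if i = j then v \<bullet> e j else 0)"
        unfolding P_def inner_sum_right using that by (intro sum.cong) (auto simp: ortho)
      then show ?thesis using that by simp
    qed
    \<comment> \<open>Bessel's inequality: the projection has the same inner product with itself as
      with \<open>v\<close>, and Cauchy-Schwarz bounds the latter.\<close>
    have "P n v \<bullet> P n v = (\<Sum>i=1..n. (v \<bullet> e i) * (e i \<bullet> P n v))"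
      by (subst (1) P_def) (simp add: inner_sum_left)
    also have "\<dots> = (\<Sum>i=1..n. (v \<bullet> e i) * (v \<bullet> e i))" by (intro sum.cong) (auto simp: e_P)
    also have "\<dots> = v \<bullet> P n v" by (simp add: P_def inner_sum_right)
    also have "\<dots> \<le> norm v * norm (P n v)" by (rule norm_cauchy_schwarz)
    finally have "norm (P n v) * norm (P n v) \<le> norm v * norm (P n v)"
      by (simp add: power2_norm_eq_inner[symmetric] power2_eq_square)
    then show ?thesis by (cases "P n v = 0") (auto simp: mult_le_cancel_right)
  qed
  have fixed: "span (e ` {1..}) \<subseteq> {s. \<exists>N. \<forall>n\<ge>N. P n s = s}"
  proof (rule span_minimal)
    have "P n (e j) = e j" if "n \<ge> j" "j \<ge> 1" for n j
    proof -
      have "P n (e j) = (\<Sum>i=1..n. if i = j then e j else 0)"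
        unfolding P_def using that by (intro sum.cong) (auto simp: ortho)
      then show ?thesis using that by simp
    qed
    then show "e ` {1..} \<subseteq> {s. \<exists>N. \<forall>n\<ge>N. P n s = s}" by auto
    have "\<exists>N. \<forall>n\<ge>N. P n (u + v) = u + v" if "\<forall>n\<ge>N. P n u = u" "\<forall>n\<ge>N'. P n v = v" for u v N N'
      using that by (intro exI[of _ "max N N'"]) (auto simp: P_add)
    then show "subspace {s. \<exists>N. \<forall>n\<ge>N. P n s = s}"
      unfolding subspace_def by (auto simp: P_scale) (simp add: P_def)
  qed
  fix r :: real assume "0 < r"
  have "h \<in> closure (span (e ` {1..}))" using assms by (simp add: orthonormal_basis_def)
  then obtain s where s: "s \<in> span (e ` {1..})" "dist s h < r / 2"
    using \<open>0 < r\<close> by (metis closure_approachable half_gt_zero)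
  then obtain N where N: "\<And>n. n \<ge> N \<Longrightarrow> P n s = s" using fixed by blast
  have "dist (P n h) h < r" if "n \<ge> N" for n
  proof -
    \<comment> \<open>As \<open>s\<close> is fixed, the error for \<open>h\<close> is that for
      \<open>h - s\<close>, at most twice its norm; this is why \<open>s\<close> was taken within
      \<open>r / 2\<close>.\<close>
    have "P n h = P n (h - s) + P n s" using P_add[of n "h - s" s] by simp
    then have "norm (P n h - h) \<le> norm (P n (h - s)) + norm (h - s)"
      using N[OF that] norm_triangle_ineq4[of "P n (h - s)" "h - s"] by (simp add: algebra_simps)
    also have "\<dots> \<le> 2 * norm (h - s)" using P_norm[of n "h - s"] by simp
    finally show ?thesis using s(2) by (simp add: dist_norm norm_minus_commute)
  qed
  then show "\<exists>no. \<forall>n\<ge>no. dist (\<Sum>j=1..n. (h \<bullet> e j) *\<^sub>R e j) h < r"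
    unfolding P_def by auto
qed

text \<open>This is the sigma-algebra generated by the first \<open>k\<close> coordinates, written
  so that each member comes with a base set in \<real>-valued \<open>k\<close>-space.\<close>

definition cylinders :: "(nat \<Rightarrow> 'h::real_inner) \<Rightarrow> nat \<Rightarrow> 'h set set" where
  "cylinders e k = {coords e {1..k} -` A | A. A \<in> sets (PiM {1..k} (\<lambda>_. borel))}"

lemma cylinders_eq_vimage_algebra:
  "cylinders e k = sets (vimage_algebra UNIV (coords e {1..k}) (PiM {1..k} (\<lambda>_. borel)))"
  by (subst sets_vimage_algebra2) (auto simp: cylinders_def coords_def space_PiM)

lemma sigma_algebra_cylinders: "sigma_algebra UNIV (cylinders e k)"
  unfolding cylinders_eq_vimage_algebra by (metis sets.sigma_algebra_axioms space_vimage_algebra)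

lemma measurable_coords [measurable]:
  fixes e :: "nat \<Rightarrow> 'h::{real_inner, second_countable_topology}"
  shows "coords e J \<in> measurable borel (PiM J (\<lambda>_. borel))"
  unfolding coords_def by measurable

lemma cylinders_sets:
  fixes e :: "nat \<Rightarrow> 'h::{real_inner, second_countable_topology}"
  shows "A \<in> cylinders e k \<Longrightarrow> A \<in> sets borel"
  using measurable_sets[OF measurable_coords[of e]] by (auto simp: cylinders_def)

lemma cylinders_Suc: "cylinders e k \<subseteq> cylinders e (Suc k)"
proof -
  let ?r = "\<lambda>x. restrict x {1..k} :: nat \<Rightarrow> real" and ?P = "\<lambda>k. PiM {1..k} (\<lambda>_. borel :: real measure)"
  have r: "?r \<in> measurable (?P (Suc k)) (?P k)"
    by (intro measurable_restrict_subset) auto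
  have coords: "coords e {1..k} h = ?r (coords e {1..Suc k} h)" for h
    by (auto simp: coords_def)
  show ?thesis
  proof
    fix X assume "X \<in> cylinders e k"
    then obtain A where A: "A \<in> sets (?P k)" "X = coords e {1..k} -` A"
      unfolding cylinders_def by auto
    \<comment> \<open>The same event one level up: its base is pulled back along the map that
      forgets the last coordinate.\<close>
    have "X = coords e {1..Suc k} -` (?r -` A \<inter> space (?P (Suc k)))"
      unfolding A(2) vimage_def coords by (auto simp: coords_def space_PiM)
    then show "X \<in> cylinders e (Suc k)"
      using measurable_sets[OF r A(1)] unfolding cylinders_def by (intro CollectI exI conjI)
  qed
qed

text \<open>Each coordinate functional is measurable for the cylinders, hence so are the partial
  sums of the orthonormal expansion and their pointwise limit, the identity.\<close>

lemma sets_borel_eq_cylinders: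
  fixes e :: "nat \<Rightarrow> 'h::{real_inner, second_countable_topology}"
  assumes e: "orthonormal_basis e"
  shows "sets (borel :: 'h measure) = sigma_sets UNIV (\<Union>k\<in>{1..}. cylinders e k)"
proof
  let ?S = "sigma UNIV (\<Union>k\<in>{1..}. cylinders e k)"
  have S: "sets ?S = sigma_sets UNIV (\<Union>k\<in>{1..}. cylinders e k)" by (subst sets_measure_of) auto
  have inner: "(\<lambda>h. h \<bullet> e j) \<in> measurable ?S borel" if "j \<ge> 1" for j
  proof (rule measurableI)
    fix A :: "real set" assume [measurable]: "A \<in> sets borel"
    let ?B = "(\<lambda>x. x j) -` A \<inter> space (PiM {1..j} (\<lambda>_. borel))"
    have "?B \<in> sets (PiM {1..j} (\<lambda>_. borel))"
      using that by (intro measurable_sets[OF measurable_component_singleton]) auto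
    moreover have "(\<lambda>h. h \<bullet> e j) -` A = coords e {1..j} -` ?B"
      using that by (auto simp: coords_def space_PiM)
    ultimately have "(\<lambda>h. h \<bullet> e j) -` A \<in> cylinders e j"
      unfolding cylinders_def by (intro CollectI exI[of _ ?B] conjI)
    then have "(\<lambda>h. h \<bullet> e j) -` A \<in> (\<Union>k\<in>{1..}. cylinders e k)"
      using that by (intro UN_I[of j]) simp
    then show "(\<lambda>h. h \<bullet> e j) -` A \<inter> space ?S \<in> sets ?S"
      unfolding S by (simp add: sigma_sets.Basic)
  qed simp
  have id: "(\<lambda>h. h) \<in> measurable ?S (borel :: 'h measure)"
  proof (rule borel_measurable_LIMSEQ_metric)
    show "(\<lambda>n. \<Sum>j=1..n. (h \<bullet> e j) *\<^sub>R e j) \<longlonglongrightarrow> h" for h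
      by (rule orthonormal_expansion[OF e])
    show "(\<lambda>h. \<Sum>j=1..n. (h \<bullet> e j) *\<^sub>R e j) \<in> measurable ?S borel" for n
      by (intro borel_measurable_sum borel_measurable_scaleR borel_measurable_const inner) simp
  qed
  show "sets borel \<subseteq> sigma_sets UNIV (\<Union>k\<in>{1..}. cylinders e k)"
  proof
    fix A :: "'h set" assume "A \<in> sets borel"
    from measurable_sets[OF id this] have "A \<in> sets ?S" by simp
    then show "A \<in> sigma_sets UNIV (\<Union>k\<in>{1..}. cylinders e k)" by (simp only: S)
  qed
  have "(\<Union>k\<in>{1..}. cylinders e k) \<subseteq> sets borel"
    by (intro UN_least subsetI) (rule cylinders_sets)
  from sets.sigma_sets_subset[OF this]
  show "sigma_sets UNIV (\<Union>k\<in>{1..}. cylinders e k) \<subseteq> sets borel" by simp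
qed

subsection \<open>Measures with given copula densities\<close>

lemma coords_vimage_PiE:
  "coords e J -` (\<Pi>\<^sub>E j\<in>J. I j) = {h. \<forall>j\<in>J. h \<bullet> e j \<in> I j}"
  by (auto simp: coords_def PiE_iff)

lemma space_unit_cube: "space (unit_cube k) = {1..k} \<rightarrow>\<^sub>E {0..1}"
  by (simp add: unit_cube_def space_PiM space_restrict_space)

lemma prob_space_unit_interval: "prob_space (restrict_space lborel {0..1::real})"
  by (rule prob_spaceI) (simp add: emeasure_restrict_space space_restrict_space)

lemma box_in_unit_cube:
  assumes "a \<in> {1..k} \<rightarrow>\<^sub>E {0..1}"
  shows "(\<Pi>\<^sub>E j\<in>{1..k}. {0..a j}) \<in> sets (unit_cube k)"
  unfolding unit_cube_def
proof (rule sets_PiM_I_finite)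
  fix j assume "j \<in> {1..k}"
  then have "a j \<le> 1" using assms by (auto dest: PiE_mem)
  then show "{0..a j} \<in> sets (restrict_space lborel {0..1})"
    by (auto simp: sets_restrict_space intro!: image_eqI[of _ _ "{0..a j}"])
qed simp

lemma measure_image_measure:
  fixes e :: "nat \<Rightarrow> 'h::{real_inner, second_countable_topology}"
  assumes "sets \<nu> = sets borel" "A \<in> sets (PiM J (\<lambda>_. borel))"
  shows "measure (image_measure e J \<nu>) A = measure \<nu> (coords e J -` A)"
proof -
  have [simp]: "space \<nu> = UNIV" using sets_eq_imp_space_eq[OF assms(1)] by simp
  have "coords e J \<in> measurable \<nu> (PiM J (\<lambda>_. borel))"
    using measurable_coords assms(1) measurable_cong_sets by blast
  then show ?thesis using assms(2) by (simp add: image_measure_def measure_distr)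
qed

section \<open>The transformed coordinates and their joint law\<close>

text \<open>The class \<open>polish_space\<close> supplies completeness and separability; infinite
  dimension is implied by the infinite orthonormal system.\<close>

locale copula_model =
  fixes e :: "nat \<Rightarrow> 'h :: {real_inner, polish_space}"
    and C c :: "nat \<Rightarrow> (nat \<Rightarrow> real) \<Rightarrow> real"
    and \<mu> :: "'h measure"
  assumes basis: "orthonormal_basis e"
    and copula_C: "\<And>k. k \<ge> 1 \<Longrightarrow> copula k (C k)"
    and consistent: "consistent_copulas C"
    and density_c: "\<And>k. k \<ge> 1 \<Longrightarrow> has_copula_density k (C k) (c k)"
    and \<mu>: "\<mu> \<in> product_measures e \<inter> continuous_measures e"
begin

abbreviation m where "m j \<equiv> marginal e j \<mu>"

definition V where "V k h = (\<lambda>j\<in>{1..k}. cdf (m j) (h \<bullet> e j))"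

text \<open>The candidate for \<nu> at level \<open>k\<close>. It lives on all Borel sets, but it is
  compared with \<nu> only on \<open>cylinders e k\<close>.\<close>

definition Q where "Q k = density \<mu> (\<lambda>h. ennreal (c k (V k h)))"

lemma sets_\<mu>: "sets \<mu> = sets borel" and prob_space_\<mu>: "prob_space \<mu>"
  using \<mu> by (auto simp: product_measures_def borel_prob_measures_def)

lemma space_\<mu>: "space \<mu> = UNIV"
  using sets_eq_imp_space_eq[OF sets_\<mu>] by simp

lemma measurable_\<mu>: "measurable \<mu> N = measurable borel N"
  using sets_\<mu> by (rule measurable_cong_sets) simp

sublocale \<mu>: prob_space \<mu> by (rule prob_space_\<mu>)

sublocale \<mu>: generating_filtration \<mu> "cylinders e"
proof (intro generating_filtration.intro generating_filtration_axioms.intro)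
  show "prob_space \<mu>" by (rule prob_space_\<mu>)
  show "sigma_algebra (space \<mu>) (cylinders e k)" for k
    unfolding space_\<mu> by (rule sigma_algebra_cylinders)
  show "cylinders e k \<subseteq> cylinders e (Suc k)" for k by (rule cylinders_Suc)
  show "sets \<mu> = sigma_sets (space \<mu>) (\<Union>k\<in>{1..}. cylinders e k)"
    unfolding space_\<mu> sets_\<mu> by (rule sets_borel_eq_cylinders[OF basis])
qed

lemma real_distribution_m: "real_distribution (m j)"
  unfolding marginal_def by (intro \<mu>.real_distribution_distr) (simp add: measurable_\<mu>)

lemma cont_m: "j \<ge> 1 \<Longrightarrow> continuous_on UNIV (cdf (m j))"
  using \<mu> by (auto simp: continuous_measures_def)

lemma cdf_m_bounds: "0 \<le> cdf (m j) x" "cdf (m j) x \<le> 1"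
proof -
  interpret real_distribution "m j" by (rule real_distribution_m)
  show "0 \<le> cdf (m j) x" "cdf (m j) x \<le> 1" by (rule cdf_nonneg cdf_bounded_prob)+
qed

lemma cdf_m_measurable: "j \<ge> 1 \<Longrightarrow> cdf (m j) \<in> measurable borel (restrict_space lborel {0..1})"
  using borel_measurable_continuous_onI[OF cont_m[of j]]
  by (intro measurable_restrict_space2) (auto simp: cdf_m_bounds)

lemma V_eq_coords: "V k h = (\<lambda>j\<in>{1..k}. cdf (m j) (coords e {1..k} h j))"
  by (auto simp: V_def coords_def)

lemma V_coords_measurable:
  "(\<lambda>x. \<lambda>j\<in>{1..k}. cdf (m j) (x j)) \<in> measurable (PiM {1..k} (\<lambda>_. borel)) (unit_cube k)"
  unfolding unit_cube_def
  by (intro measurable_restrict measurable_compose[OF measurable_component_singleton] cdf_m_measurable) auto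

lemma V_measurable: "V k \<in> measurable \<mu> (unit_cube k)"
  unfolding V_eq_coords measurable_\<mu>
  using measurable_compose[OF measurable_coords V_coords_measurable] .

lemma V_in_cube: "V k h \<in> {1..k} \<rightarrow>\<^sub>E {0..1}"
  using measurable_space[OF V_measurable, of h k] by (simp add: space_\<mu> space_unit_cube)

text \<open>The coordinates are independent under \<mu>, and each becomes uniform under its own
  continuous distribution function; checking boxes suffices for a product measure.\<close>

lemma distr_V: "distr \<mu> (unit_cube k) (V k) = unit_cube k"
  unfolding unit_cube_def
proof (rule product_sigma_finite.PiM_eqI)
  interpret U: prob_space "restrict_space lborel {0..1::real}" by (rule prob_space_unit_interval)
  show "product_sigma_finite (\<lambda>_::nat. restrict_space lborel {0..1::real})"
    by (simp add: product_sigma_finite_def U.sigma_finite_measure_axioms)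
  fix A assume A: "\<And>i. i \<in> {1..k} \<Longrightarrow> A i \<in> sets (restrict_space lborel {0..1::real})"
  let ?I = "restrict_space lborel {0..1::real}"
  let ?B = "\<lambda>i. cdf (m i) -` A i"
  have B: "?B i \<in> sets borel" if "i \<in> {1..k}" for i
    using measurable_sets[OF cdf_m_measurable A[OF that]] that by simp
  have box: "(\<Pi>\<^sub>E i\<in>{1..k}. A i) \<in> sets (PiM {1..k} (\<lambda>_. ?I))"
    using A by (intro sets_PiM_I_finite) auto
  have "emeasure (distr \<mu> (PiM {1..k} (\<lambda>_. ?I)) (V k)) (\<Pi>\<^sub>E i\<in>{1..k}. A i)
      = emeasure \<mu> (V k -` (\<Pi>\<^sub>E i\<in>{1..k}. A i))"
    using V_measurable box by (simp add: emeasure_distr unit_cube_def space_\<mu>)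
  \<comment> \<open>The box is viewed as a set of full coordinate sequences, since independence is
    given as an identity of measures on the infinite product.\<close>
  also have "V k -` (\<Pi>\<^sub>E i\<in>{1..k}. A i)
      = coords e {1..} -` prod_emb {1..} m {1..k} (\<Pi>\<^sub>E i\<in>{1..k}. ?B i)"
    by (auto simp: V_def coords_def prod_emb_def PiE_iff marginal_def space_PiM extensional_def)
  also have "emeasure \<mu> \<dots> = emeasure (image_measure e {1..} \<mu>) (prod_emb {1..} m {1..k} (\<Pi>\<^sub>E i\<in>{1..k}. ?B i))"
  proof -
    have "prod_emb {1..} m {1..k} (\<Pi>\<^sub>E i\<in>{1..k}. ?B i) \<in> sets (PiM {1..} m)"
      using B by (intro sets_PiM_I) (auto simp: marginal_def)
    also have "sets (PiM {1..} m) = sets (PiM {1..} (\<lambda>_. borel))"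
      by (intro sets_PiM_cong) (auto simp: marginal_def)
    finally show ?thesis
      unfolding image_measure_def
      by (subst emeasure_distr) (auto simp: measurable_\<mu> space_\<mu>)
  qed
  also have "image_measure e {1..} \<mu> = PiM {1..} m"
    using \<mu> by (simp add: product_measures_def)
  also have "emeasure \<dots> (prod_emb {1..} m {1..k} (\<Pi>\<^sub>E i\<in>{1..k}. ?B i)) = (\<Prod>i\<in>{1..k}. emeasure (m i) (?B i))"
    using real_distribution_m B by (intro emeasure_PiM_emb) (auto simp: real_distribution_def marginal_def)
  also have "\<dots> = (\<Prod>i\<in>{1..k}. emeasure ?I (A i))"
  proof (intro prod.cong refl)
    fix i assume i: "i \<in> {1..k}"
    interpret real_distribution "m i" by (rule real_distribution_m)
    have "cdf (m i) \<in> measurable (m i) ?I"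
      using cdf_m_measurable i unfolding marginal_def by simp
    then have "emeasure (m i) (?B i) = emeasure (distr (m i) ?I (cdf (m i))) (A i)"
      using A[OF i] by (simp add: emeasure_distr)
    also have "distr (m i) ?I (cdf (m i)) = ?I" using i by (intro distr_cdf_uniform cont_m) simp
    finally show "emeasure (m i) (?B i) = emeasure ?I (A i)" .
  qed
  finally show "emeasure (distr \<mu> (PiM {1..k} (\<lambda>_. ?I)) (V k)) (\<Pi>\<^sub>E i\<in>{1..k}. A i) = \<dots>" .
qed simp_all

lemma
  assumes "k \<ge> 1"
  shows c_measurable: "c k \<in> borel_measurable (unit_cube k)"
    and C_eq_integral: "u \<in> {1..k} \<rightarrow>\<^sub>E {0..1} \<Longrightarrow>
      ennreal (C k u) = (\<integral>\<^sup>+v\<in>(\<Pi>\<^sub>E j\<in>{1..k}. {0..u j}). ennreal (c k v) \<partial>unit_cube k)"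
  using density_c[OF assms] by (simp_all add: has_copula_density_def)

lemma c_V_measurable: "k \<ge> 1 \<Longrightarrow> (\<lambda>h. c k (V k h)) \<in> borel_measurable \<mu>"
  using V_measurable c_measurable by (rule measurable_compose)

lemma C_nonneg:
  assumes k: "k \<ge> 1" and u: "u \<in> {1..k} \<rightarrow>\<^sub>E {0..1}"
  shows "0 \<le> C k u"
proof -
  obtain M where "\<forall>u\<in>{1..k} \<rightarrow>\<^sub>E {0..1}. C k u = measure M (\<Pi>\<^sub>E j\<in>{1..k}. {0..u j})"
    using copula_C[OF k] unfolding copula_def by blast
  from bspec[OF this u] show ?thesis by simp
qed

lemma C_ones:
  assumes k: "k \<ge> 1"
  shows "C k (\<lambda>i\<in>{1..k}. 1) = 1"
proof -
  have "\<forall>j\<in>{1..k}. \<forall>t\<in>{0..1}. C k (\<lambda>i\<in>{1..k}. if i = j then t else 1) = t"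
    using copula_C[OF k] unfolding copula_def by (rule conjunct2)
  from this[THEN bspec, of 1, THEN bspec, of 1] k show ?thesis by simp
qed

section \<open>Copula values as masses of lower orthants\<close>

lemma emeasure_Q_vimage:
  assumes k: "k \<ge> 1" and A: "A \<in> sets (unit_cube k)"
  shows "emeasure (Q k) (V k -` A) = (\<integral>\<^sup>+v\<in>A. ennreal (c k v) \<partial>unit_cube k)"
proof -
  have VA: "V k -` A \<in> sets \<mu>"
    using measurable_sets[OF V_measurable A] by (simp add: space_\<mu>)
  have "emeasure (Q k) (V k -` A) = (\<integral>\<^sup>+h. ennreal (c k (V k h)) * indicator A (V k h) \<partial>\<mu>)"
    using c_V_measurable[OF k] VA unfolding Q_def
    by (subst emeasure_density) (auto intro!: nn_integral_cong simp: indicator_def)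
  also have "\<dots> = (\<integral>\<^sup>+v. ennreal (c k v) * indicator A v \<partial>distr \<mu> (unit_cube k) (V k))"
    using c_measurable[OF k] A V_measurable by (subst nn_integral_distr) auto
  finally show ?thesis unfolding distr_V .
qed

text \<open>The endpoint \<open>a j = 1\<close> is paired with the whole line, which makes this cover cylinders too.\<close>

lemma emeasure_Q_box:
  assumes k: "k \<ge> 1" and a: "a \<in> {1..k} \<rightarrow>\<^sub>E {0..1}"
    and I: "\<And>j. j \<in> {1..k} \<Longrightarrow> I j = UNIV \<and> a j = 1 \<or> (\<exists>x. I j = {..x} \<and> a j = cdf (m j) x)"
  shows "emeasure (Q k) {h. \<forall>j\<in>{1..k}. h \<bullet> e j \<in> I j} = ennreal (C k a)"
proof -
  \<comment> \<open>A half-line and the matching sublevel set of the distribution function differ by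
    a null set. For the whole line both conditions always hold.\<close>
  have "AE h in \<mu>. h \<bullet> e j \<in> I j \<longleftrightarrow> cdf (m j) (h \<bullet> e j) \<le> a j" if j: "j \<in> {1..k}" for j
  proof -
    interpret real_distribution "m j" by (rule real_distribution_m)
    have "AE y in distr \<mu> borel (\<lambda>h. h \<bullet> e j). y \<in> I j \<longleftrightarrow> cdf (m j) y \<le> a j"
      using I[OF j] cdf_bounded_prob AE_le_iff_cdf_le[OF cont_m] j unfolding marginal_def[symmetric] by auto
    then show ?thesis by (intro AE_distrD[of _ \<mu> borel]) (auto simp: measurable_\<mu>)
  qed
  then have "AE h in \<mu>. \<forall>j\<in>{1..k}. h \<bullet> e j \<in> I j \<longleftrightarrow> cdf (m j) (h \<bullet> e j) \<le> a j"
    by (intro AE_finite_allI) auto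
  then have AE: "AE h in \<mu>. h \<in> {h. \<forall>j\<in>{1..k}. h \<bullet> e j \<in> I j} \<longleftrightarrow> h \<in> V k -` (\<Pi>\<^sub>E j\<in>{1..k}. {0..a j})"
  proof eventually_elim
    case (elim h)
    have "\<forall>j\<in>{1..k}. 0 \<le> V k h j" using V_in_cube[of k h] by (auto dest: PiE_mem)
    then show ?case using elim by (auto simp: V_def PiE_iff)
  qed
  have "I j \<in> sets borel" if "j \<in> {1..k}" for j using I[OF that] by auto
  then have "(\<Pi>\<^sub>E j\<in>{1..k}. I j) \<in> sets (PiM {1..k} (\<lambda>_. borel))" by (intro sets_PiM_I_finite) auto
  from measurable_sets[OF measurable_coords[of e] this]
  have meas: "{h. \<forall>j\<in>{1..k}. h \<bullet> e j \<in> I j} \<in> sets \<mu>" by (simp add: coords_vimage_PiE sets_\<mu>)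
  have meas': "V k -` (\<Pi>\<^sub>E j\<in>{1..k}. {0..a j}) \<in> sets \<mu>"
    using measurable_sets[OF V_measurable box_in_unit_cube[OF a]] by (simp add: space_\<mu>)
  \<comment> \<open>The exceptional \<mu>-null set is also null for \<open>Q k\<close>, which has a
    density with respect to \<mu>.\<close>
  have "AE h in Q k. h \<in> {h. \<forall>j\<in>{1..k}. h \<bullet> e j \<in> I j} \<longleftrightarrow> h \<in> V k -` (\<Pi>\<^sub>E j\<in>{1..k}. {0..a j})"
    unfolding Q_def using AE c_V_measurable[OF k] by (subst AE_density) auto
  then have "emeasure (Q k) {h. \<forall>j\<in>{1..k}. h \<bullet> e j \<in> I j} = emeasure (Q k) (V k -` (\<Pi>\<^sub>E j\<in>{1..k}. {0..a j}))"
    using meas meas' by (intro emeasure_eq_AE) (auto simp: Q_def)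
  also have "\<dots> = ennreal (C k a)"
    unfolding emeasure_Q_vimage[OF k box_in_unit_cube[OF a]] C_eq_integral[OF k a] ..
  finally show ?thesis .
qed

lemma sets_Q [simp]: "sets (Q k) = sets \<mu>" and space_Q [simp]: "space (Q k) = UNIV"
  by (simp_all add: Q_def space_\<mu>)

text \<open>The whole space is the box with unrestricted coordinates; it corresponds to the corner
  of ones, where a copula equals \<open>1\<close>.\<close>

lemma prob_space_Q:
  assumes k: "k \<ge> 1"
  shows "prob_space (Q k)"
proof (rule prob_spaceI)
  have "emeasure (Q k) {h. \<forall>j\<in>{1..k}. h \<bullet> e j \<in> UNIV} = ennreal (C k (\<lambda>j\<in>{1..k}. 1))"
    using k by (intro emeasure_Q_box) auto
  then show "emeasure (Q k) (space (Q k)) = 1" using C_ones[OF k] by simp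
qed

lemma cdf_in_cube: "(\<lambda>j\<in>{1..k}. cdf (m j) (x j)) \<in> {1..k} \<rightarrow>\<^sub>E {0..1}"
  by (auto simp: cdf_m_bounds)

lemma emeasure_Q_atMost:
  assumes k: "k \<ge> 1"
  shows "emeasure (Q k) {h. \<forall>j\<in>{1..k}. h \<bullet> e j \<le> x j} = ennreal (C k (\<lambda>j\<in>{1..k}. cdf (m j) (x j)))"
proof -
  have "emeasure (Q k) {h. \<forall>j\<in>{1..k}. h \<bullet> e j \<in> {..x j}} = ennreal (C k (\<lambda>j\<in>{1..k}. cdf (m j) (x j)))"
    by (intro emeasure_Q_box[OF k cdf_in_cube]) auto
  then show ?thesis by simp
qed

text \<open>Both measures give the lower orthants the same mass, so their images under the first
  \<open>k\<close> coordinates coincide, and cylinders are preimages under these.\<close>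

lemma emeasure_cylinders_eq_Q:
  assumes k: "k \<ge> 1" and N: "sets N = sets \<mu>"
    and eq: "\<And>x. emeasure N {h. \<forall>j\<in>{1..k}. h \<bullet> e j \<le> x j} = ennreal (C k (\<lambda>j\<in>{1..k}. cdf (m j) (x j)))"
    and A: "A \<in> cylinders e k"
  shows "emeasure N A = emeasure (Q k) A"
proof -
  let ?P = "PiM {1..k} (\<lambda>_. borel :: real measure)"
  interpret Q: prob_space "Q k" by (rule prob_space_Q[OF k])
  have coords: "coords e {1..k} \<in> measurable L ?P" if "sets L = sets \<mu>" for L
    using that sets_\<mu> measurable_coords measurable_cong_sets by metis
  have space: "space L = UNIV" if "sets L = sets \<mu>" for L
    using that sets_eq_imp_space_eq space_\<mu> by metis
  have "emeasure (distr L ?P (coords e {1..k})) (\<Pi>\<^sub>E i\<in>{1..k}. {..x i})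
      = emeasure L {h. \<forall>j\<in>{1..k}. h \<bullet> e j \<le> x j}" if "sets L = sets \<mu>" for L x
  proof -
    have "(\<Pi>\<^sub>E i\<in>{1..k}. {..x i}) \<in> sets ?P" by (intro sets_PiM_I_finite) auto
    then show ?thesis using coords[OF that] by (simp add: emeasure_distr coords_vimage_PiE space[OF that])
  qed
  then have "distr (Q k) ?P (coords e {1..k}) = distr N ?P (coords e {1..k})"
    using N eq emeasure_Q_atMost[OF k] coords[of "Q k"]
    by (intro measure_eqI_PiM_atMost) (auto intro: Q.finite_measure_distr)
  moreover obtain B where B: "B \<in> sets ?P" "A = coords e {1..k} -` B"
    using A by (auto simp: cylinders_def)
  ultimately show ?thesis
    using emeasure_distr[OF coords[OF N] B(1)] emeasure_distr[OF coords[of "Q k"] B(1)] B(2) space[OF N]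
    by simp
qed

text \<open>A lower orthant in \<open>k\<close> coordinates is a box in \<open>Suc k\<close>
  coordinates with the last one unrestricted. This sets the last argument of the copula to
  \<open>1\<close>, where consistency applies.\<close>

lemma Q_consistent:
  assumes k: "k \<ge> 1" and A: "A \<in> cylinders e k"
  shows "emeasure (Q (Suc k)) A = emeasure (Q k) A"
proof (rule emeasure_cylinders_eq_Q[OF k _ _ A])
  fix x
  let ?u = "\<lambda>j\<in>{1..k}. cdf (m j) (x j)"
  let ?I = "\<lambda>j. if j = Suc k then UNIV else {..x j}"
  have "emeasure (Q (Suc k)) {h. \<forall>j\<in>{1..Suc k}. h \<bullet> e j \<in> ?I j} = ennreal (C (Suc k) (?u(Suc k := 1)))"
  proof (rule emeasure_Q_box)
    show "?u(Suc k := 1) \<in> {1..Suc k} \<rightarrow>\<^sub>E {0..1}"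
      using cdf_in_cube[of x k] by (auto simp: PiE_iff extensional_def)
  qed auto
  also have "{h. \<forall>j\<in>{1..Suc k}. h \<bullet> e j \<in> ?I j} = {h. \<forall>j\<in>{1..k}. h \<bullet> e j \<le> x j}"
    by (auto split: if_splits)
  also have "C (Suc k) (?u(Suc k := 1)) = C k ?u"
    using consistent k cdf_in_cube[of x k] unfolding consistent_copulas_def by blast
  finally show "emeasure (Q (Suc k)) {h. \<forall>j\<in>{1..k}. h \<bullet> e j \<le> x j} = ennreal (C k ?u)" .
qed simp

lemma emeasure_eq_Q_if_coupling:
  assumes \<nu>: "\<nu> \<in> borel_prob_measures" and coupling: "copula_coupling e C \<mu> \<nu>"
    and k: "k \<ge> 1" and A: "A \<in> cylinders e k"
  shows "emeasure \<nu> A = emeasure (Q k) A"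
proof (rule emeasure_cylinders_eq_Q[OF k _ _ A])
  have sets: "sets \<nu> = sets borel" using \<nu> by (simp add: borel_prob_measures_def)
  then show "sets \<nu> = sets \<mu>" by (simp add: sets_\<mu>)
  interpret \<nu>: prob_space \<nu> using \<nu> by (simp add: borel_prob_measures_def)
  fix x
  have "\<forall>I. (\<forall>j\<in>{1..k}. I j \<in> half_lines) \<longrightarrow> measure (image_measure e {1..k} \<nu>) (\<Pi>\<^sub>E j\<in>{1..k}. I j) =
      C k (\<lambda>j\<in>{1..k}. measure (m j) (I j))"
    using coupling k unfolding copula_coupling_def by blast
  from this[THEN spec, of "\<lambda>j. {..x j}"]
  have "measure (image_measure e {1..k} \<nu>) (\<Pi>\<^sub>E j\<in>{1..k}. {..x j}) = C k (\<lambda>j\<in>{1..k}. measure (m j) {..x j})"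
    by (auto simp: half_lines_def)
  moreover have "(\<Pi>\<^sub>E j\<in>{1..k}. {..x j}) \<in> sets (PiM {1..k} (\<lambda>_. borel))"
    by (intro sets_PiM_I_finite) auto
  ultimately show "emeasure \<nu> {h. \<forall>j\<in>{1..k}. h \<bullet> e j \<le> x j} = ennreal (C k (\<lambda>j\<in>{1..k}. cdf (m j) (x j)))"
    by (simp add: \<nu>.emeasure_eq_measure measure_image_measure[OF sets] coords_vimage_PiE cdf_def)
qed

lemma coupling_if_emeasure_eq_Q:
  assumes sets: "sets \<nu> = sets \<mu>"
    and eq: "\<And>k A. k \<ge> 1 \<Longrightarrow> A \<in> cylinders e k \<Longrightarrow> emeasure \<nu> A = emeasure (Q k) A"
  shows "copula_coupling e C \<mu> \<nu>"
  unfolding copula_coupling_def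
proof (intro allI impI)
  fix k :: nat and I :: "nat \<Rightarrow> real set"
  assume k: "1 \<le> k" and I: "\<forall>j\<in>{1..k}. I j \<in> half_lines"
  from I have "\<forall>j\<in>{1..k}. \<exists>y. I j = {..y}" by (auto simp: half_lines_def)
  from bchoice[OF this] obtain x where x: "\<forall>j\<in>{1..k}. I j = {..x j}" by blast
  then have I_eq: "(\<Pi>\<^sub>E j\<in>{1..k}. I j) = (\<Pi>\<^sub>E j\<in>{1..k}. {..x j})" by (intro PiE_cong) auto
  have box: "(\<Pi>\<^sub>E j\<in>{1..k}. {..x j}) \<in> sets (PiM {1..k} (\<lambda>_. borel))"
    by (intro sets_PiM_I_finite) auto
  then have "coords e {1..k} -` (\<Pi>\<^sub>E j\<in>{1..k}. {..x j}) \<in> cylinders e k"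
    unfolding cylinders_def by blast
  then have "emeasure \<nu> {h. \<forall>j\<in>{1..k}. h \<bullet> e j \<le> x j} = ennreal (C k (\<lambda>j\<in>{1..k}. cdf (m j) (x j)))"
    using eq[OF k] emeasure_Q_atMost[OF k] by (simp add: coords_vimage_PiE)
  then have "measure \<nu> {h. \<forall>j\<in>{1..k}. h \<bullet> e j \<le> x j} = C k (\<lambda>j\<in>{1..k}. cdf (m j) (x j))"
    \<comment> \<open>\<open>ennreal\<close> truncates negative numbers to \<open>0\<close>, so
      nonnegativity of the copula is what allows passing back to reals.\<close>
    using C_nonneg[OF k cdf_in_cube] by (simp add: measure_def)
  moreover have "(\<lambda>j\<in>{1..k}. measure (m j) (I j)) = (\<lambda>j\<in>{1..k}. cdf (m j) (x j))"
    using x by (auto simp: cdf_def)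
  ultimately show "measure (image_measure e {1..k} \<nu>) (\<Pi>\<^sub>E j\<in>{1..k}. I j) = C k (\<lambda>j\<in>{1..k}. measure (m j) (I j))"
    unfolding I_eq using sets sets_\<mu> box by (simp add: measure_image_measure coords_vimage_PiE)
qed

section \<open>Contiguity and uniform integrability as uniform absolute continuity\<close>

text \<open>Image measures of base sets are measures of cylinders, so contiguity is a statement
  about sequences with one cylinder per level. From left to right the filtration argument applies;
  conversely \<delta> works for all levels at once.\<close>

lemma contiguous_iff_uniformly_ac:
  assumes \<nu>: "\<nu> \<in> borel_prob_measures"
  shows "contiguous (\<lambda>k. image_measure e {1..k} \<nu>) (\<lambda>k. image_measure e {1..k} \<mu>) \<longleftrightarrow>
    uniformly_ac (cylinders e) (\<lambda>_. \<nu>) \<mu>"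
proof
  have sets: "sets \<nu> = sets borel" and "prob_space \<nu>"
    using \<nu> by (auto simp: borel_prob_measures_def)
  interpret \<nu>: prob_space \<nu> by fact
  have sets_image: "sets (image_measure e J \<mu>) = sets (PiM J (\<lambda>_. borel))" for J
    by (simp add: image_measure_def)
  {
    assume contig: "contiguous (\<lambda>k. image_measure e {1..k} \<nu>) (\<lambda>k. image_measure e {1..k} \<mu>)"
    show "uniformly_ac (cylinders e) (\<lambda>_. \<nu>) \<mu>"
    proof (rule \<mu>.uniformly_ac_if_contiguous)
      show "finite_measure \<nu>" by unfold_locales
      fix A assume A: "\<And>k. 1 \<le> k \<Longrightarrow> A k \<in> cylinders e k" and lim: "(\<lambda>k. measure \<mu> (A k)) \<longlonglongrightarrow> 0"
      have "\<forall>k. \<exists>B. 1 \<le> k \<longrightarrow> B \<in> sets (PiM {1..k} (\<lambda>_. borel)) \<and> A k = coords e {1..k} -` B"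
        using A unfolding cylinders_def by blast
      from choice[OF this] obtain B
        where B: "\<And>k. 1 \<le> k \<Longrightarrow> B k \<in> sets (PiM {1..k} (\<lambda>_. borel))" "\<And>k. 1 \<le> k \<Longrightarrow> A k = coords e {1..k} -` B k"
        by blast
      have eq: "measure (image_measure e {1..k} L) (B k) = measure L (A k)" if "1 \<le> k" "sets L = sets borel" for k L
        using measure_image_measure[OF that(2) B(1)[OF that(1)]] B(2)[OF that(1)] by simp
      have "(\<lambda>k. measure (image_measure e {1..k} \<mu>) (B k)) \<longlonglongrightarrow> 0"
        \<comment> \<open>The value at index \<open>0\<close> is arbitrary; the identity for
          \<open>k \<ge> 1\<close> is enough for the limit.\<close>
        by (rule Lim_transform_eventually[OF lim])
           (use eq sets_\<mu> in \<open>auto simp: eventually_sequentially intro!: exI[of _ 1]\<close>)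
      then have "(\<lambda>k. measure (image_measure e {1..k} \<nu>) (B k)) \<longlonglongrightarrow> 0"
        using contig[unfolded contiguous_def, rule_format, of B] B(1) sets_image by blast
      then show "(\<lambda>k. measure \<nu> (A k)) \<longlonglongrightarrow> 0"
        by (rule Lim_transform_eventually)
           (use eq sets in \<open>auto simp: eventually_sequentially intro!: exI[of _ 1]\<close>)
    qed
  next
    assume ac: "uniformly_ac (cylinders e) (\<lambda>_. \<nu>) \<mu>"
    show "contiguous (\<lambda>k. image_measure e {1..k} \<nu>) (\<lambda>k. image_measure e {1..k} \<mu>)"
      unfolding contiguous_def sets_image
    proof (intro allI impI)
      fix A assume A: "\<forall>k\<ge>1. A k \<in> sets (PiM {1..k} (\<lambda>_. borel))"
        and lim: "(\<lambda>k. measure (image_measure e {1..k} \<mu>) (A k)) \<longlonglongrightarrow> 0"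
      show "(\<lambda>k. measure (image_measure e {1..k} \<nu>) (A k)) \<longlonglongrightarrow> 0"
      proof (rule order_tendstoI)
        fix r :: real assume "0 < r"
        then obtain \<delta> where \<delta>: "\<delta> > 0"
          "\<forall>k\<ge>1. \<forall>A\<in>cylinders e k. measure \<mu> A < \<delta> \<longrightarrow> measure \<nu> A \<le> r / 2"
          using ac[unfolded uniformly_ac_def, rule_format, of "r / 2"] by auto
        have "\<forall>\<^sub>F k in sequentially. 1 \<le> k" by (rule eventually_ge_at_top)
        with order_tendstoD(2)[OF lim \<delta>(1)]
        show "\<forall>\<^sub>F k in sequentially. measure (image_measure e {1..k} \<nu>) (A k) < r"
        proof eventually_elim
          case (elim k)
          then have Ak: "A k \<in> sets (PiM {1..k} (\<lambda>_. borel))" using A by blast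
          then have "coords e {1..k} -` A k \<in> cylinders e k" unfolding cylinders_def by blast
          moreover have "measure \<mu> (coords e {1..k} -` A k) < \<delta>"
            using elim measure_image_measure[OF sets_\<mu> Ak] by simp
          ultimately have "measure \<nu> (coords e {1..k} -` A k) \<le> r / 2"
            using \<delta>(2) elim(2) by blast
          then show ?case using measure_image_measure[OF sets Ak] \<open>0 < r\<close> by simp
        qed
      next
        fix a :: real assume "a < 0"
        then show "\<forall>\<^sub>F k in sequentially. a < measure (image_measure e {1..k} \<nu>) (A k)"
          by (intro always_eventually allI) (rule less_le_trans[OF _ measure_nonneg])
      qed
    qed
  }
qed

text \<open>These translate the tail integrals over the cube into \<open>Q k\<close>-masses of
  events depending on the first \<open>k\<close> coordinates, to which \<open>uniformly_ac\<close>
  can be applied.\<close>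

lemma
  assumes k: "k \<ge> 1"
  shows superlevel_integral: "(\<integral>\<^sup>+u\<in>{u \<in> {1..k} \<rightarrow>\<^sub>E {0..1}. c k u \<ge> r}. ennreal (c k u) \<partial>unit_cube k)
      = emeasure (Q k) {h. c k (V k h) \<ge> r}" (is ?integral)
    and superlevel_cylinder: "{h. c k (V k h) \<ge> r} \<in> cylinders e k" (is ?cylinder)
proof -
  let ?A = "{u \<in> {1..k} \<rightarrow>\<^sub>E {0..1}. c k u \<ge> r}"
  have "?A = c k -` {r..} \<inter> space (unit_cube k)" by (auto simp: space_unit_cube)
  then have A: "?A \<in> sets (unit_cube k)" using measurable_sets[OF c_measurable[OF k], of "{r..}"] by simp
  have V: "V k -` ?A = {h. c k (V k h) \<ge> r}" using V_in_cube by auto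
  show ?integral using emeasure_Q_vimage[OF k A] V by simp
  let ?T = "\<lambda>x. \<lambda>j\<in>{1..k}. cdf (m j) (x j)"
  have "{h. c k (V k h) \<ge> r} = coords e {1..k} -` (?T -` ?A \<inter> space (PiM {1..k} (\<lambda>_. borel)))"
    unfolding V[symmetric] V_eq_coords[abs_def] by (auto simp: coords_def space_PiM cdf_m_bounds)
  moreover have "?T -` ?A \<inter> space (PiM {1..k} (\<lambda>_. borel)) \<in> sets (PiM {1..k} (\<lambda>_. borel))"
    by (rule measurable_sets[OF V_coords_measurable A])
  ultimately show ?cylinder unfolding cylinders_def by (intro CollectI exI conjI)
qed

text \<open>Split an event at density level \<open>r\<close>: below it the \<open>Q k\<close>-mass
  is at most \<open>r\<close> times the \<mu>-mass, and above it at most the tail integral, which is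
  small uniformly in \<open>k\<close>.\<close>

lemma uniformly_ac_if_uniformly_integrable:
  assumes ui: "uniformly_integrable_densities c"
  shows "uniformly_ac (cylinders e) Q \<mu>"
  unfolding uniformly_ac_def
proof (intro allI impI)
  fix \<epsilon> :: real assume "0 < \<epsilon>"
  let ?tail = "\<lambda>k r. \<integral>\<^sup>+u\<in>{u \<in> {1..k} \<rightarrow>\<^sub>E {0..1}. c k u \<ge> r}. ennreal (c k u) \<partial>unit_cube k"
  have "\<forall>\<^sub>F r in at_top. (SUP k\<in>{1..}. ?tail k r) < ennreal (\<epsilon> / 2)"
    using ui \<open>0 < \<epsilon>\<close> unfolding uniformly_integrable_densities_def
    by (intro order_tendstoD(2)) (auto simp: ennreal_less_zero_iff)
  moreover have "\<forall>\<^sub>F r :: real in at_top. 0 < r" by (rule eventually_gt_at_top)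
  ultimately have "\<forall>\<^sub>F r in at_top. (SUP k\<in>{1..}. ?tail k r) < ennreal (\<epsilon> / 2) \<and> 0 < r"
    by (rule eventually_conj)
  then obtain r :: real where r: "(SUP k\<in>{1..}. ?tail k r) < ennreal (\<epsilon> / 2)" "0 < r"
    using eventually_happens'[OF trivial_limit_at_top_linorder] by blast
  show "\<exists>\<delta>>0. \<forall>k\<ge>1. \<forall>A\<in>cylinders e k. measure \<mu> A < \<delta> \<longrightarrow> measure (Q k) A \<le> \<epsilon>"
  \<comment> \<open>With this \<delta> the part below level \<open>r\<close> contributes at most
    \<open>\<epsilon> / 2\<close>; the tail accounts for the other half.\<close>
  proof (intro exI[of _ "\<epsilon> / (2 * r)"] conjI allI impI ballI)
    show "0 < \<epsilon> / (2 * r)" using \<open>0 < \<epsilon>\<close> \<open>0 < r\<close> by simp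
    fix k :: nat and A assume k: "1 \<le> k" and A: "A \<in> cylinders e k" "measure \<mu> A < \<epsilon> / (2 * r)"
    interpret Q: prob_space "Q k" by (rule prob_space_Q[OF k])
    let ?S = "{h. c k (V k h) \<ge> r}"
    have A_sets: "A \<in> sets \<mu>" "?S \<in> sets \<mu>"
      using \<mu>.F_sets[OF k] A(1) superlevel_cylinder[OF k] by auto
    then have AS: "A - ?S \<in> sets \<mu>" by blast
    have "emeasure (Q k) (A - ?S) = (\<integral>\<^sup>+h. ennreal (c k (V k h)) * indicator (A - ?S) h \<partial>\<mu>)"
      using c_V_measurable[OF k] AS unfolding Q_def by (subst emeasure_density) auto
    also have "\<dots> \<le> (\<integral>\<^sup>+h. ennreal r * indicator (A - ?S) h \<partial>\<mu>)"
      by (intro nn_integral_mono) (auto simp: indicator_def intro: ennreal_leI)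
    also have "\<dots> = ennreal r * emeasure \<mu> (A - ?S)" using AS by (simp add: nn_integral_cmult)
    also have "\<dots> = ennreal (r * measure \<mu> (A - ?S))"
      using r(2) by (simp add: \<mu>.emeasure_eq_measure ennreal_mult)
    finally have "measure (Q k) (A - ?S) \<le> r * measure \<mu> (A - ?S)"
      using r(2) by (simp add: Q.emeasure_eq_measure)
    also have "\<dots> \<le> r * measure \<mu> A"
      using r(2) A_sets by (intro mult_left_mono \<mu>.finite_measure_mono) auto
    also have "\<dots> \<le> r * (\<epsilon> / (2 * r))" using A(2) r(2) by (intro mult_left_mono) auto
    also have "\<dots> = \<epsilon> / 2" using r(2) by simp
    finally have "measure (Q k) (A - ?S) \<le> \<epsilon> / 2" .
    moreover have "emeasure (Q k) ?S \<le> (SUP k\<in>{1..}. ?tail k r)"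
      unfolding superlevel_integral[OF k, symmetric] using k by (intro SUP_upper) simp
    then have "ennreal (measure (Q k) ?S) < ennreal (\<epsilon> / 2)"
      using r(1) unfolding Q.emeasure_eq_measure by (rule le_less_trans)
    then have "measure (Q k) ?S \<le> \<epsilon> / 2" by (simp add: ennreal_less_iff)
    moreover have "measure (Q k) A \<le> measure (Q k) (A - ?S) + measure (Q k) ?S"
      using A_sets by (intro order_trans[OF Q.finite_measure_mono measure_Un_le]) auto
    ultimately show "measure (Q k) A \<le> \<epsilon>" by simp
  qed
qed

text \<open>Markov's inequality for a density of total mass \<open>1\<close>; the bound is the same
  for all \<open>k\<close>.\<close>

lemma measure_superlevel_le:
  assumes k: "k \<ge> 1" and r: "0 < r"
  shows "measure \<mu> {h. c k (V k h) \<ge> r} \<le> 1 / r"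
proof -
  interpret Q: prob_space "Q k" by (rule prob_space_Q[OF k])
  let ?S = "{h. c k (V k h) \<ge> r}"
  have S: "?S \<in> sets \<mu>" using \<mu>.F_sets[OF k] superlevel_cylinder[OF k] by auto
  have "ennreal (r * measure \<mu> ?S) = (\<integral>\<^sup>+h. ennreal r * indicator ?S h \<partial>\<mu>)"
    using S r by (simp add: nn_integral_cmult \<mu>.emeasure_eq_measure ennreal_mult)
  also have "\<dots> \<le> (\<integral>\<^sup>+h. ennreal (c k (V k h)) * indicator ?S h \<partial>\<mu>)"
    by (intro nn_integral_mono) (auto simp: indicator_def intro: ennreal_leI)
  also have "\<dots> = emeasure (Q k) ?S"
    using c_V_measurable[OF k] S unfolding Q_def by (subst emeasure_density) auto
  also have "\<dots> \<le> 1" by (rule Q.emeasure_le_1)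
  finally have "r * measure \<mu> ?S \<le> 1" by simp
  then show ?thesis using r by (simp add: field_simps)
qed

text \<open>By Markov's inequality the superlevel sets are \<mu>-small uniformly in \<open>k\<close>
  once \<open>r\<close> exceeds \<open>1 / \<delta>\<close>, and the tail integrals are their
  \<open>Q k\<close>-masses.\<close>

lemma uniformly_integrable_if_uniformly_ac:
  assumes ac: "uniformly_ac (cylinders e) Q \<mu>"
  shows "uniformly_integrable_densities c"
  unfolding uniformly_integrable_densities_def
proof (rule order_tendstoI)
  let ?tail = "\<lambda>k r. \<integral>\<^sup>+u\<in>{u \<in> {1..k} \<rightarrow>\<^sub>E {0..1}. c k u \<ge> r}. ennreal (c k u) \<partial>unit_cube k"
  fix x :: ennreal assume "0 < x"
  obtain \<epsilon> where \<epsilon>: "0 < \<epsilon>" "ennreal \<epsilon> < x"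
  proof (cases x)
    case (real r)
    then show ?thesis using \<open>0 < x\<close> that[of "r / 2"] by (auto simp: ennreal_less_iff)
  next
    case top
    then show ?thesis using that[of 1] by simp
  qed
  obtain \<delta> where \<delta>: "\<delta> > 0" "\<forall>k\<ge>1. \<forall>A\<in>cylinders e k. measure \<mu> A < \<delta> \<longrightarrow> measure (Q k) A \<le> \<epsilon>"
    using ac \<epsilon>(1) unfolding uniformly_ac_def by blast
  have "\<forall>\<^sub>F r :: real in at_top. 1 / \<delta> < r" by (rule eventually_gt_at_top)
  then show "\<forall>\<^sub>F r in at_top. (SUP k\<in>{1..}. ?tail k r) < x"
  proof eventually_elim
    case (elim r)
    moreover have "0 < r" using \<delta>(1) elim by (auto intro: less_trans[of 0 "1 / \<delta>"])
    ultimately have r: "0 < r" "1 / r < \<delta>"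
      using \<delta>(1) by (auto simp: field_simps)
    have "?tail k r \<le> ennreal \<epsilon>" if "k \<in> {1..}" for k
    proof -
      have k: "k \<ge> 1" using that by simp
      interpret Q: prob_space "Q k" by (rule prob_space_Q[OF k])
      have "measure (Q k) {h. c k (V k h) \<ge> r} \<le> \<epsilon>"
        using \<delta>(2) k superlevel_cylinder[OF k, of r] measure_superlevel_le[OF k r(1)] r(2) by fastforce
      then show ?thesis
        unfolding superlevel_integral[OF k] Q.emeasure_eq_measure by (rule ennreal_leI)
    qed
    then have "(SUP k\<in>{1..}. ?tail k r) \<le> ennreal \<epsilon>" by (rule SUP_least)
    then show ?case using \<epsilon>(2) by (rule le_less_trans)
  qed
qed simp

lemma uniformly_ac_cong_Q:
  assumes "\<And>k A. k \<ge> 1 \<Longrightarrow> A \<in> cylinders e k \<Longrightarrow> emeasure \<nu> A = emeasure (Q k) A"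
  shows "uniformly_ac (cylinders e) (\<lambda>_. \<nu>) \<mu> \<longleftrightarrow> uniformly_ac (cylinders e) Q \<mu>"
proof -
  have "measure \<nu> A = measure (Q k) A" if "k \<ge> 1" "A \<in> cylinders e k" for k A
    using assms[OF that] by (simp add: measure_def)
  then show ?thesis unfolding uniformly_ac_def by (simp cong: ball_cong)
qed

section \<open>Construction of the coupling and the converse\<close>

lemma obtain_contiguous_coupling:
  assumes "uniformly_integrable_densities c"
  obtains \<nu> where "\<nu> \<in> borel_prob_measures"
    "contiguous (\<lambda>k. image_measure e {1..k} \<nu>) (\<lambda>k. image_measure e {1..k} \<mu>)"
    "copula_coupling e C \<mu> \<nu>"
proof -
  have ac: "uniformly_ac (cylinders e) Q \<mu>"
    using assms by (rule uniformly_ac_if_uniformly_integrable)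
  obtain \<nu> where \<nu>: "prob_space \<nu>" "sets \<nu> = sets \<mu>"
    "\<And>k A. k \<ge> 1 \<Longrightarrow> A \<in> cylinders e k \<Longrightarrow> emeasure \<nu> A = emeasure (Q k) A"
    by (rule \<mu>.extension_if_uniformly_ac[of Q]) (use prob_space_Q Q_consistent ac in auto)
  have borel: "\<nu> \<in> borel_prob_measures"
    using \<nu>(1,2) by (simp add: borel_prob_measures_def sets_\<mu>)
  show thesis
  proof (rule that[OF borel])
    show "contiguous (\<lambda>k. image_measure e {1..k} \<nu>) (\<lambda>k. image_measure e {1..k} \<mu>)"
      unfolding contiguous_iff_uniformly_ac[OF borel] using uniformly_ac_cong_Q[OF \<nu>(3)] ac by simp
    show "copula_coupling e C \<mu> \<nu>" using \<nu>(2,3) by (rule coupling_if_emeasure_eq_Q)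
  qed
qed

text \<open>The copula condition forces any such \<nu> to agree with \<open>Q k\<close> on the
  cylinders of level \<open>k\<close>, so what contiguity says about \<nu> carries over to the
  densities.\<close>

lemma
  assumes \<nu>: "\<nu> \<in> borel_prob_measures"
    and contig: "contiguous (\<lambda>k. image_measure e {1..k} \<nu>) (\<lambda>k. image_measure e {1..k} \<mu>)"
    and coupling: "copula_coupling e C \<mu> \<nu>"
  shows uniformly_integrable_if_contiguous_coupling: "uniformly_integrable_densities c"
    and absolutely_continuous_if_contiguous_coupling: "absolutely_continuous \<mu> \<nu>"
proof -
  have ac: "uniformly_ac (cylinders e) (\<lambda>_. \<nu>) \<mu>"
    using contig unfolding contiguous_iff_uniformly_ac[OF \<nu>] .
  then show "uniformly_integrable_densities c"
    using uniformly_ac_cong_Q[OF emeasure_eq_Q_if_coupling[OF \<nu> coupling]]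
    by (intro uniformly_integrable_if_uniformly_ac) simp
  show "absolutely_continuous \<mu> \<nu>"
    using \<nu> ac by (intro \<mu>.absolutely_continuous_if_uniformly_ac)
      (auto simp: borel_prob_measures_def sets_\<mu> prob_space.finite_measure)
qed

end

theorem theorem5p3:
  fixes e :: "nat \<Rightarrow> 'h :: {real_inner, polish_space}"
    and C c :: "nat \<Rightarrow> (nat \<Rightarrow> real) \<Rightarrow> real"
    and \<mu> :: "'h measure"
  assumes "orthonormal_basis e"
    and "\<And>k. k \<ge> 1 \<Longrightarrow> copula k (C k)"
    and "consistent_copulas C"
    and "\<And>k. k \<ge> 1 \<Longrightarrow> has_copula_density k (C k) (c k)"
    and "\<mu> \<in> product_measures e \<inter> continuous_measures e"
  shows "(uniformly_integrable_densities c \<longleftrightarrow>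
      (\<exists>\<nu> \<in> borel_prob_measures.
         contiguous (\<lambda>k. image_measure e {1..k} \<nu>) (\<lambda>k. image_measure e {1..k} \<mu>) \<and>
         copula_coupling e C \<mu> \<nu>)) \<and>
      (\<forall>\<nu> \<in> borel_prob_measures.
         contiguous (\<lambda>k. image_measure e {1..k} \<nu>) (\<lambda>k. image_measure e {1..k} \<mu>) \<and>
         copula_coupling e C \<mu> \<nu> \<longrightarrow> absolutely_continuous \<mu> \<nu>)"
proof -
  interpret copula_model e C c \<mu> using assms by (rule copula_model.intro)
  show ?thesis
  proof (intro conjI iffI ballI impI)
    assume "uniformly_integrable_densities c"
    then show "\<exists>\<nu>\<in>borel_prob_measures.
        contiguous (\<lambda>k. image_measure e {1..k} \<nu>) (\<lambda>k. image_measure e {1..k} \<mu>) \<and>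
        copula_coupling e C \<mu> \<nu>"
      by (rule obtain_contiguous_coupling) blast
  qed (elim bexE conjE uniformly_integrable_if_contiguous_coupling
      absolutely_continuous_if_contiguous_coupling; assumption)+
qed

end
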